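(* Let $T,S\in\mathcal{B}_A(\mathcal{H})$, $\alpha\in [0,1]$, $r\geq 1$ and $\beta\geq 0$. Then $$w_A^{4r}(S^{\sharp_A} T)\leq \frac{1+\alpha+2\beta}{8(1+\beta)}\left\|\left(T^{\sharp_A} T\right)^{2r}+\left(S^{\sharp_A} S\right)^{2r}\right\|_A^2+\frac{1-\alpha}{2(1+\beta)}\,w_A^{2r}\left(S^{\sharp_A} S\,T^{\sharp_A} T\right).$$
   Context: $(\mathcal{H},\langle\cdot,\cdot\rangle)$ is a nontrivial complex Hilbert space, $\mathcal{B}(\mathcal{H})$ is the algebra of bounded linear operators on $\mathcal{H}$, and $A\in\mathcal{B}(\mathcal{H})$ is a positive operator, i.e. $\langle Ax,x\rangle\ge 0$ for all $x\in\mathcal{H}$. The semi-inner product induced by $A$ is $\langle x,y\rangle_A=\langle Ax,y\rangle$, with seminorm $\|x\|_A=\sqrt{\langle x,x\rangle_A}$ on $\mathcal{H}$. $\mathcal{B}_A(\mathcal{H})=\{T\in\mathcal{B}(\mathcal{H}): \operatorname{ran}(T^*A)\subseteq\operatorname{ran}(A)\}$ is the set of operators admitting an $A$-adjoint. For $T\in\mathcal{B}_A(\mathcal{H})$, $T^{\sharp_A}=A^{\dagger}T^*A$ (with $A^\dagger$ the Moore-Penrose inverse of $A$) is the unique bounded solution $X$ of $AX=T^*A$ whose range is contained in $\overline{\operatorname{ran}(A)}$; it satisfies $\langle Tx,y\rangle_A=\langle x,T^{\sharp_A}y\rangle_A$ for all $x,y\in\mathcal{H}$. For $T\in\mathcal{B}_A(\mathcal{H})$,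 the $A$-operator seminorm is $\|T\|_A=\sup\{\|Tx\|_A: x\in\mathcal{H},\ \|x\|_A=1\}$ and the $A$-numerical radius is $w_A(T)=\sup\{|\langle Tx,x\rangle_A|: x\in\mathcal{H},\ \|x\|_A=1\}$; $w_A^s(T)$ means $(w_A(T))^s$. Convention on powers: an operator $P$ is $A$-positive if $AP$ is positive; $T^{\sharp_A}T$ and $S^{\sharp_A}S$ are $A$-positive. For integer exponents, powers are ordinary operator powers. For non-integer $s\ge 1$, powers of $A$-positive operators $P\in\mathcal{B}_A(\mathcal{H})$ are understood on the Hilbert space $\mathcal{H}_A$ obtained by completing $\mathcal{H}/\ker A$ with respect to $\langle\cdot,\cdot\rangle_A$: $P$ induces a bounded positive operator $\widetilde P$ on $\mathcal{H}_A$, $P^s$ stands for $\widetilde P^{\,s}$ (continuous functional calculus), and the $A$-seminorm of a sum of such powers is the operator norm on $\mathcal{H}_A$ (for integer $s$ this agrees with the seminorm above). *)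

theory Defs
  imports "HOL-Analysis.Analysis" "HOL-Computational_Algebra.Polynomial"
begin

(* The inner product is linear in the first argument.  Completeness, and positivity and
   definiteness of the inner product, come from class banach together with cinner_self. *)
class chilbert_space = banach +
  fixes scaleC :: "complex \<Rightarrow> 'a \<Rightarrow> 'a" (infixr "*\<^sub>C" 75)
    and cinner :: "'a \<Rightarrow> 'a \<Rightarrow> complex"
  assumes scaleC_add_right: "c *\<^sub>C (x + y) = c *\<^sub>C x + c *\<^sub>C y"
    and scaleC_add_left: "(c + d) *\<^sub>C x = c *\<^sub>C x + d *\<^sub>C x"
    and scaleC_scaleC: "c *\<^sub>C (d *\<^sub>C x) = (c * d) *\<^sub>C x"
    and scaleC_of_real: "complex_of_real t *\<^sub>C x = t *\<^sub>R x"
    and cinner_add_left: "cinner (x + y) z = cinner x z + cinner y z"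
    and cinner_scaleC_left: "cinner (c *\<^sub>C x) y = c * cinner x y"
    and cinner_commute: "cinner x y = cnj (cinner y x)"
    and cinner_self: "cinner x x = complex_of_real ((norm x)\<^sup>2)"

instantiation complex :: chilbert_space
begin

definition scaleC_complex :: "complex \<Rightarrow> complex \<Rightarrow> complex" where
  "scaleC_complex c x = c * x"

definition cinner_complex :: "complex \<Rightarrow> complex \<Rightarrow> complex" where
  "cinner_complex x y = x * cnj y"

instance
proof
  fix c d x y z :: complex and t :: real
  show "c *\<^sub>C (x + y) = c *\<^sub>C x + c *\<^sub>C y"
    by (simp only: scaleC_complex_def distrib_left)
  show "(c + d) *\<^sub>C x = c *\<^sub>C x + d *\<^sub>C x"
    by (simp only: scaleC_complex_def distrib_right)
  show "c *\<^sub>C (d *\<^sub>C x) = (c * d) *\<^sub>C x"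
    by (simp only: scaleC_complex_def mult.assoc)
  show "complex_of_real t *\<^sub>C x = t *\<^sub>R x"
    by (simp only: scaleC_complex_def scaleR_conv_of_real)
  show "cinner (x + y) z = cinner x z + cinner y z"
    by (simp only: cinner_complex_def distrib_right)
  show "cinner (c *\<^sub>C x) y = c * cinner x y"
    by (simp only: cinner_complex_def scaleC_complex_def mult.assoc)
  show "cinner x y = cnj (cinner y x)"
    by (simp only: cinner_complex_def complex_cnj_mult complex_cnj_cnj mult.commute)
  show "cinner x x = complex_of_real ((norm x)\<^sup>2)"
    unfolding cinner_complex_def by (rule complex_norm_square [symmetric])
qed

end

(* Bounded complex-linear operators on a subspace K; the values of f outside K play no role.
   B(H) is the case K = UNIV. *)
definition bounded_clinear_on :: "'a::chilbert_space set \<Rightarrow> ('a \<Rightarrow> 'a) \<Rightarrow> bool" where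
  "bounded_clinear_on K f \<longleftrightarrow>
     (\<forall>x\<in>K. f x \<in> K) \<and>
     (\<forall>x\<in>K. \<forall>y\<in>K. f (x + y) = f x + f y) \<and>
     (\<forall>c. \<forall>x\<in>K. f (c *\<^sub>C x) = c *\<^sub>C f x) \<and>
     (\<exists>B. \<forall>x\<in>K. norm (f x) \<le> B * norm x)"

definition cpositive :: "('h::chilbert_space \<Rightarrow> 'h) \<Rightarrow> bool" where
  "cpositive A \<longleftrightarrow> (\<forall>x. cinner (A x) x \<in> \<real>\<^sub>\<ge>\<^sub>0)"

definition cadjoint :: "('h::chilbert_space \<Rightarrow> 'h) \<Rightarrow> 'h \<Rightarrow> 'h" where
  "cadjoint T = (THE T'. \<forall>x y. cinner (T x) y = cinner x (T' y))"

definition ortho_compl :: "'h::chilbert_space set \<Rightarrow> 'h set" where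
  "ortho_compl M = {x. \<forall>y\<in>M. cinner x y = 0}"

(* The range of A need not be closed, so the Moore-Penrose inverse is in general only defined
   on the dense subspace ran(A) + ran(A)^perp; outside of it the value is unspecified. *)
definition moore_penrose :: "('h::chilbert_space \<Rightarrow> 'h) \<Rightarrow> 'h \<Rightarrow> 'h" where
  "moore_penrose A y =
     (THE x. x \<in> ortho_compl {z. A z = 0} \<and> y - A x \<in> ortho_compl (range A))"

definition A_inner :: "('h::chilbert_space \<Rightarrow> 'h) \<Rightarrow> 'h \<Rightarrow> 'h \<Rightarrow> complex" where
  "A_inner A x y = cinner (A x) y"

definition A_norm :: "('h::chilbert_space \<Rightarrow> 'h) \<Rightarrow> 'h \<Rightarrow> real" where
  "A_norm A x = sqrt (Re (A_inner A x x))"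

definition A_adjointable :: "('h::chilbert_space \<Rightarrow> 'h) \<Rightarrow> ('h \<Rightarrow> 'h) set" where
  "A_adjointable A =
     {T. bounded_clinear_on UNIV T \<and> range (cadjoint T \<circ> A) \<subseteq> range A}"

definition A_adjoint :: "('h::chilbert_space \<Rightarrow> 'h) \<Rightarrow> ('h \<Rightarrow> 'h) \<Rightarrow> 'h \<Rightarrow> 'h" where
  "A_adjoint A T = moore_penrose A \<circ> cadjoint T \<circ> A"

(* In the next three definitions all quantities are nonnegative, so inserting 0 only fixes the
   convention that the supremum over the empty set is 0 (relevant when A = 0, resp. K = {0}). *)
definition A_opnorm :: "('h::chilbert_space \<Rightarrow> 'h) \<Rightarrow> ('h \<Rightarrow> 'h) \<Rightarrow> real" where
  "A_opnorm A T = Sup (insert 0 {A_norm A (T x) | x. A_norm A x = 1})"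

definition A_numrad :: "('h::chilbert_space \<Rightarrow> 'h) \<Rightarrow> ('h \<Rightarrow> 'h) \<Rightarrow> real" where
  "A_numrad A T = Sup (insert 0 {cmod (A_inner A (T x) x) | x. A_norm A x = 1})"

definition opnorm_on :: "'a::chilbert_space set \<Rightarrow> ('a \<Rightarrow> 'a) \<Rightarrow> real" where
  "opnorm_on K f = Sup (insert 0 {norm (f x) | x. x \<in> K \<and> norm x = 1})"

(* J induces an isometric linear embedding of H / ker A, with the inner product of A, onto a
   dense subspace of K; K is complete, being closed in a Hilbert space.  Hence (K, J) is a
   completion, unique up to a unitary.  Letting K be a closed subspace of 'k instead of all of
   'k ensures that a completion is available for every A, without a type depending on A:
   for 'k = 'h take J to be the square root of A and K the closure of its range. *)
definition A_completion ::
    "('h::chilbert_space \<Rightarrow> 'h) \<Rightarrow> 'k::chilbert_space set \<Rightarrow> ('h \<Rightarrow> 'k) \<Rightarrow> bool" where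
  "A_completion A K J \<longleftrightarrow>
     (\<forall>x y. J (x + y) = J x + J y) \<and>
     (\<forall>c x. J (c *\<^sub>C x) = c *\<^sub>C J x) \<and>
     (\<forall>x y. cinner (J x) (J y) = A_inner A x y) \<and>
     K = closure (range J)"

(* Operators on K given by a definite description are normalised to vanish outside K. *)
definition induced_op ::
    "'k::chilbert_space set \<Rightarrow> ('h::chilbert_space \<Rightarrow> 'k) \<Rightarrow> ('h \<Rightarrow> 'h) \<Rightarrow> 'k \<Rightarrow> 'k" where
  "induced_op K J P =
     (THE f. bounded_clinear_on K f \<and> (\<forall>x. x \<notin> K \<longrightarrow> f x = 0) \<and> (\<forall>x. f (J x) = J (P x)))"

definition spectrum_on :: "'a::chilbert_space set \<Rightarrow> ('a \<Rightarrow> 'a) \<Rightarrow> complex set" where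
  "spectrum_on K f =
     {z. \<not> (\<exists>g. bounded_clinear_on K g \<and>
            (\<forall>x\<in>K. g (f x - z *\<^sub>C x) = x \<and> f (g x) - z *\<^sub>C g x = x))}"

definition op_poly :: "complex poly \<Rightarrow> ('a::chilbert_space \<Rightarrow> 'a) \<Rightarrow> 'a \<Rightarrow> 'a" where
  "op_poly p f x = (\<Sum>i\<le>degree p. coeff p i *\<^sub>C (f ^^ i) x)"

(* Continuous functional calculus of a self-adjoint operator f on K: \<phi>(f) is the norm limit
   of p_n(f) whenever the polynomials p_n converge to \<phi> uniformly on the spectrum of f. *)
definition fun_calc_on ::
    "'a::chilbert_space set \<Rightarrow> (complex \<Rightarrow> complex) \<Rightarrow> ('a \<Rightarrow> 'a) \<Rightarrow> 'a \<Rightarrow> 'a" where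
  "fun_calc_on K \<phi> f =
     (THE g. bounded_clinear_on K g \<and> (\<forall>x. x \<notin> K \<longrightarrow> g x = 0) \<and>
        (\<forall>p. uniform_limit (spectrum_on K f) (\<lambda>n z. poly (p n) z) \<phi> sequentially \<longrightarrow>
             (\<lambda>n. opnorm_on K (\<lambda>x. op_poly (p n) f x - g x)) \<longlonglongrightarrow> 0))"

(* The spectrum of a positive operator consists of nonnegative reals z, where Re z = z. *)
definition op_powr_on :: "'a::chilbert_space set \<Rightarrow> ('a \<Rightarrow> 'a) \<Rightarrow> real \<Rightarrow> 'a \<Rightarrow> 'a" where
  "op_powr_on K f s = fun_calc_on K (\<lambda>z. complex_of_real (Re z powr s)) f"

(* The A-seminorm of P^s + Q^s for A-positive P, Q: ordinary powers for integer s, otherwise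
   powers and operator norm on the completion (K, J). *)
definition A_powr_sum_opnorm ::
    "('h::chilbert_space \<Rightarrow> 'h) \<Rightarrow> 'k::chilbert_space set \<Rightarrow> ('h \<Rightarrow> 'k) \<Rightarrow>
      ('h \<Rightarrow> 'h) \<Rightarrow> ('h \<Rightarrow> 'h) \<Rightarrow> real \<Rightarrow> real" where
  "A_powr_sum_opnorm A K J P Q s =
     (if s \<in> \<nat> then A_opnorm A (\<lambda>x. (P ^^ nat \<lfloor>s\<rfloor>) x + (Q ^^ nat \<lfloor>s\<rfloor>) x)
      else opnorm_on K
        (\<lambda>x. op_powr_on K (induced_op K J P) s x + op_powr_on K (induced_op K J Q) s x))"

end

theory Submission
  imports Defs "HOL-Computational_Algebra.Fundamental_Theorem_Algebra"
begin

text \<open>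
  Write \<open>P\<close> for the composition of \<^term>\<open>S\<close> with its A-adjoint, \<open>Q\<close> for that of \<^term>\<open>T\<close>, and let
  \<open>x\<close> be a vector of A-norm one; inner products and norms below are those induced by \<^term>\<open>A\<close>.  By the Cauchy-Schwarz inequality the square \<open>m\<close> of the modulus of
  \<open>\<langle>Tx, Sx\<rangle>\<close> is at most \<open>\<langle>Qx, x\<rangle> \<langle>x, Px\<rangle>\<close>.  This product has two bounds: the Cauchy-Schwarz bound
  \<open>c = \<parallel>Qx\<parallel> \<parallel>Px\<parallel>\<close>, and Buzano's bound \<open>(c + w) / 2\<close>, where \<open>w\<close> is the A-numerical radius of
  \<open>PQ\<close>.  Raise both to the power \<open>s = 2r\<close>, using the convexity of that power in the second one, and
  take their convex combination with weights \<open>1 - l\<close> and \<open>l\<close>, where \<open>l = (1 - \<alpha>) / (1 + \<beta>)\<close>.  The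
  result is the claim, provided that \<open>c\<^sup>s\<close> is at most a quarter of the square of the A-seminorm of
  \<open>Q\<^sup>s + P\<^sup>s\<close>.  Since \<open>4uv \<le> (u + v)\<^sup>2\<close>, this follows from \<open>\<parallel>Px\<parallel>\<^sup>s \<le> \<langle>P\<^sup>sx, x\<rangle>\<close>
  and the same inequality for \<open>Q\<close>.

  The last inequality is Jensen's inequality for the convex function \<open>u \<mapsto> u\<^sup>s\<^sup>/\<^sup>2\<close> of \<open>P\<^sup>2\<close>; it
  needs \<open>s \<ge> 2\<close>.  It is proved by the polynomial functional calculus: a polynomial with real coefficients
  that is nonnegative on the spectrum of a positive operator is positive at that operator
  (\<open>op_poly_positive\<close>), because the infimum of the numerical range of a symmetric operator belongs to its
  spectrum and a complex polynomial splits into linear factors.  The same fact bounds the norm of a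
  polynomial of the operator by its supremum on the spectrum (\<open>norm_op_poly_le\<close>).  Hence
  polynomials that converge uniformly on the spectrum give convergent operators, which shows that the
  functional calculus is well defined (\<open>fun_calc_on_limit\<close>), and Weierstrass approximation carries
  Jensen's inequality to arbitrary real exponents (\<open>op_powr_on\<close>).  Integer powers are covered by
  the polynomial statement itself.

  To apply this on the completion, \<open>P\<close> and \<open>Q\<close> have to be bounded for the A-seminorm, which the
  definition of A-adjointable operators does not say.  The range inclusion makes a
  certain family of vectors weakly bounded, hence bounded, which gives
  \<open>\<parallel>ATz\<parallel> \<le> C \<parallel>Az\<parallel>\<close> (\<open>norm_A_T_le\<close>), and Krein's argument on iterates of a symmetrisable
  operator turns this into a bound for the seminorm (\<open>Krein_bound\<close>).
\<close>

section \<open>Hilbert space geometry\<close>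

lemma cinner_add_right: "cinner x (y + z) = cinner x y + cinner x (z::'a::chilbert_space)"
  by (metis cinner_add_left cinner_commute complex_cnj_add)

lemma cinner_scaleC_right: "cinner x (c *\<^sub>C y) = cnj c * cinner x (y::'a::chilbert_space)"
  by (metis cinner_commute cinner_scaleC_left complex_cnj_mult)

lemma cinner_scaleR_left: "cinner (r *\<^sub>R x) y = r *\<^sub>R cinner x (y::'a::chilbert_space)"
  by (metis cinner_scaleC_left scaleC_of_real scaleR_conv_of_real)

lemma cinner_scaleR_right: "cinner x (r *\<^sub>R y) = r *\<^sub>R cinner x (y::'a::chilbert_space)"
  by (metis cinner_scaleC_right scaleC_of_real scaleR_conv_of_real complex_cnj_complex_of_real)

lemma cinner_minus_left: "cinner (- x) y = - cinner x (y::'a::chilbert_space)"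
  using cinner_scaleR_left[of "-1" x y] by simp

lemma cinner_minus_right: "cinner x (- y) = - cinner x (y::'a::chilbert_space)"
  using cinner_scaleR_right[of x "-1" y] by simp

lemma cinner_diff_left: "cinner (x - y) z = cinner x z - cinner y (z::'a::chilbert_space)"
  using cinner_add_left[of x "-y" z] by (simp add: cinner_minus_left)

lemma cinner_diff_right: "cinner x (y - z) = cinner x y - cinner x (z::'a::chilbert_space)"
  using cinner_add_right[of x y "-z"] by (simp add: cinner_minus_right)

lemma cinner_zero_left [simp]: "cinner 0 (x::'a::chilbert_space) = 0"
  using cinner_scaleR_left[of 0 x x] by simp

lemma cinner_zero_right [simp]: "cinner (x::'a::chilbert_space) 0 = 0"
  using cinner_scaleR_right[of x 0 x] by simp

lemmas cinner_algebra = cinner_add_left cinner_add_right cinner_diff_left cinner_diff_right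
  cinner_scaleC_left cinner_scaleC_right cinner_scaleR_left cinner_scaleR_right

lemma scaleC_zero_left [simp]: "0 *\<^sub>C (x::'a::chilbert_space) = 0"
  using scaleC_of_real[of 0 x] by simp

lemma scaleC_zero_right [simp]: "c *\<^sub>C (0::'a::chilbert_space) = 0"
  using scaleC_add_right[of c 0 "0::'a"] by simp

lemma scaleC_one [simp]: "1 *\<^sub>C (x::'a::chilbert_space) = x"
  using scaleC_of_real[of 1 x] by simp

lemma scaleC_minus_left: "(- c) *\<^sub>C (x::'a::chilbert_space) = - (c *\<^sub>C x)"
  using scaleC_add_left[of "-c" c x] by (simp add: eq_neg_iff_add_eq_0)

lemma uminus_eq_scaleC: "- (x::'a::chilbert_space) = (-1) *\<^sub>C x"
  by (simp add: scaleC_minus_left)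

lemma scaleC_minus_right: "c *\<^sub>C (- x) = - (c *\<^sub>C (x::'a::chilbert_space))"
  using scaleC_add_right[of c "-x" x] by (simp add: eq_neg_iff_add_eq_0)

lemma scaleC_diff_right: "c *\<^sub>C (x - y) = c *\<^sub>C x - c *\<^sub>C (y::'a::chilbert_space)"
  using scaleC_add_right[of c x "-y"] by (simp add: scaleC_minus_right)

lemma norm_sq_cinner: "(norm x)\<^sup>2 = Re (cinner x (x::'a::chilbert_space))"
  by (simp add: cinner_self)

lemma norm_scaleC: "norm (c *\<^sub>C x) = cmod c * norm (x::'a::chilbert_space)"
proof -
  have "complex_of_real ((norm (c *\<^sub>C x))\<^sup>2) = (c * cnj c) * complex_of_real ((norm x)\<^sup>2)"
    by (metis cinner_self cinner_scaleC_left cinner_scaleC_right mult.assoc mult.left_commute)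
  also have "\<dots> = complex_of_real ((cmod c * norm x)\<^sup>2)"
    by (simp add: complex_norm_square[symmetric] power_mult_distrib)
  finally have "(norm (c *\<^sub>C x))\<^sup>2 = (cmod c * norm x)\<^sup>2"
    using of_real_eq_iff by blast
  then show ?thesis by simp
qed

lemma norm_add_sq:
  "(norm (x + y))\<^sup>2 = (norm x)\<^sup>2 + 2 * Re (cinner x y) + (norm (y::'a::chilbert_space))\<^sup>2"
  using cinner_commute[of y x]
  by (simp add: norm_sq_cinner cinner_algebra)

lemma norm_diff_sq:
  "(norm (x - y))\<^sup>2 = (norm x)\<^sup>2 - 2 * Re (cinner x y) + (norm (y::'a::chilbert_space))\<^sup>2"
  using norm_add_sq[of x "-y"] by (simp add: cinner_minus_right)

lemma parallelogram:
  "(norm (x + y))\<^sup>2 + (norm (x - y))\<^sup>2 = 2 * (norm x)\<^sup>2 + 2 * (norm (y::'a::chilbert_space))\<^sup>2"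
  by (simp add: norm_add_sq norm_diff_sq)

lemma Cauchy_Schwarz_cinner: "cmod (cinner x y) \<le> norm x * norm (y::'a::chilbert_space)"
proof (cases "y = 0")
  case False
  define c where "c = cinner x y / (norm y)\<^sup>2"
  have "0 \<le> (norm (x - c *\<^sub>C y))\<^sup>2" by simp
  also have "\<dots> = (norm x)\<^sup>2 - 2 * Re (cnj c * cinner x y) + (cmod c)\<^sup>2 * (norm y)\<^sup>2"
    by (simp add: norm_diff_sq cinner_scaleC_right norm_scaleC power_mult_distrib)
  also have "cnj c * cinner x y = complex_of_real ((cmod (cinner x y))\<^sup>2 / (norm y)\<^sup>2)"
    by (simp add: c_def complex_norm_square mult.commute del: of_real_power)
  also have "(cmod c)\<^sup>2 * (norm y)\<^sup>2 = (cmod (cinner x y))\<^sup>2 / (norm y)\<^sup>2"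
    using False by (simp add: c_def norm_divide norm_mult power_divide power2_eq_square)
  finally have "(cmod (cinner x y))\<^sup>2 / (norm y)\<^sup>2 \<le> (norm x)\<^sup>2" by simp
  then have "(cmod (cinner x y))\<^sup>2 \<le> (norm x * norm y)\<^sup>2"
    using False by (simp add: field_simps power_mult_distrib)
  then show ?thesis by (rule power2_le_imp_le) simp
qed simp

lemma Re_cinner_le: "Re (cinner x y) \<le> norm x * norm (y::'a::chilbert_space)"
  using Cauchy_Schwarz_cinner[of x y] complex_Re_le_cmod order_trans by blast

lemma bounded_bilinear_cinner: "bounded_bilinear (cinner :: 'a::chilbert_space \<Rightarrow> 'a \<Rightarrow> complex)"
proof
  show "\<exists>K. \<forall>a b::'a. norm (cinner a b) \<le> norm a * norm b * K"
    by (intro exI[of _ 1]) (simp add: Cauchy_Schwarz_cinner)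
qed (simp_all add: cinner_algebra)

lemmas tendsto_cinner = bounded_bilinear.tendsto[OF bounded_bilinear_cinner]

lemma tendsto_scaleC:
  fixes X :: "nat \<Rightarrow> 'a::chilbert_space"
  assumes "X \<longlonglongrightarrow> x" shows "(\<lambda>n. c *\<^sub>C X n) \<longlonglongrightarrow> c *\<^sub>C x"
proof -
  have "bounded_linear (\<lambda>x::'a. c *\<^sub>C x)"
  proof
    show "\<exists>K. \<forall>x::'a. norm (c *\<^sub>C x) \<le> norm x * K"
      by (intro exI[of _ "cmod c"]) (simp add: norm_scaleC)
    show "c *\<^sub>C (r *\<^sub>R b) = r *\<^sub>R (c *\<^sub>C b)" for r and b :: 'a
      by (metis scaleC_of_real scaleC_scaleC mult.commute)
  qed (simp add: scaleC_add_right)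
  then show ?thesis using assms by (rule bounded_linear.tendsto)
qed

lemma cinner_eq_0_imp:
  assumes "\<And>y. cinner x y = 0" shows "x = (0::'a::chilbert_space)"
  using assms[of x] by (simp add: cinner_self)

text \<open>Reflecting \<^term>\<open>a\<close> in the line spanned by the unit vector \<^term>\<open>e\<close> preserves its norm, so
  the inequality of Cauchy and Schwarz, applied to the reflected vector and \<^term>\<open>b\<close>, gives
  Buzano's inequality.\<close>
lemma Buzano:
  fixes a b e :: "'a::chilbert_space"
  assumes "norm e = 1"
  shows "cmod (cinner a e) * cmod (cinner e b) \<le> (norm a * norm b + cmod (cinner a b)) / 2"
proof -
  define v where "v = (2 * cinner a e) *\<^sub>C e - a"
  have "cinner a e * cinner e a = complex_of_real ((cmod (cinner a e))\<^sup>2)"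
    using cinner_commute[of e a] complex_norm_square[of "cinner a e"] by simp
  then have "(norm v)\<^sup>2 = (norm a)\<^sup>2"
    by (simp add: v_def norm_diff_sq norm_scaleC assms cinner_scaleC_left norm_mult
        power_mult_distrib mult.assoc)
  then have "norm v = norm a" by simp
  then have "cmod (cinner v b) \<le> norm a * norm b"
    using Cauchy_Schwarz_cinner[of v b] by simp
  moreover have "2 * (cinner a e * cinner e b) = cinner v b + cinner a b"
    by (simp add: v_def cinner_algebra)
  ultimately have "cmod (2 * (cinner a e * cinner e b)) \<le> norm a * norm b + cmod (cinner a b)"
    by (metis add_right_mono norm_triangle_ineq order_trans)
  then show ?thesis by (simp add: norm_mult)
qed

section \<open>Orthogonal projection, Riesz representation and adjoints\<close>

definition closed_csubspace :: "'a::chilbert_space set \<Rightarrow> bool" where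
  "closed_csubspace K \<longleftrightarrow> closed K \<and> 0 \<in> K \<and> (\<forall>x\<in>K. \<forall>y\<in>K. x + y \<in> K) \<and> (\<forall>c. \<forall>x\<in>K. c *\<^sub>C x \<in> K)"

lemma closed_csubspaceD:
  assumes "closed_csubspace K"
  shows "closed K" "0 \<in> K" "x \<in> K \<Longrightarrow> y \<in> K \<Longrightarrow> x + y \<in> K" "x \<in> K \<Longrightarrow> c *\<^sub>C x \<in> K"
    "x \<in> K \<Longrightarrow> r *\<^sub>R x \<in> K" "x \<in> K \<Longrightarrow> - x \<in> K" "x \<in> K \<Longrightarrow> y \<in> K \<Longrightarrow> x - y \<in> K"
proof -
  show *: "closed K" "0 \<in> K" "x \<in> K \<Longrightarrow> y \<in> K \<Longrightarrow> x + y \<in> K" "x \<in> K \<Longrightarrow> c *\<^sub>C x \<in> K" for x y c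
    using assms by (auto simp: closed_csubspace_def)
  show **: "x \<in> K \<Longrightarrow> r *\<^sub>R x \<in> K" for x r
    using *(4)[of x "complex_of_real r"] by (simp add: scaleC_of_real)
  show ***: "x \<in> K \<Longrightarrow> - x \<in> K" for x
    using **[of x "-1"] by simp
  show "x \<in> K \<Longrightarrow> y \<in> K \<Longrightarrow> x - y \<in> K"
    using *(3)[of x "-y"] *** by simp
qed

text \<open>By the parallelogram law a minimising sequence for the distance from \<^term>\<open>x\<close> is Cauchy; its
  limit is the foot of the perpendicular.\<close>
lemma orthogonal_projection_exists:
  fixes K :: "'a::chilbert_space set"
  assumes K: "closed_csubspace K"
  obtains p where "p \<in> K" "\<And>y. y \<in> K \<Longrightarrow> cinner (x - p) y = 0"
proof -
  note KD = closed_csubspaceD[OF K]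
  define d where "d = Inf ((\<lambda>y. (norm (x - y))\<^sup>2) ` K)"
  have bdd: "bdd_below ((\<lambda>y. (norm (x - y))\<^sup>2) ` K)"
    by (rule bdd_belowI[of _ 0]) auto
  have ne: "(\<lambda>y. (norm (x - y))\<^sup>2) ` K \<noteq> {}" using KD(2) by auto
  have d_le: "d \<le> (norm (x - y))\<^sup>2" if "y \<in> K" for y
    unfolding d_def using bdd that by (intro cInf_lower) auto
  have "\<exists>y\<in>K. (norm (x - y))\<^sup>2 < d + inverse (real (Suc n))" for n
    using cInf_lessD[OF ne, of "d + inverse (real (Suc n))"] by (auto simp: d_def)
  then obtain Y where Y: "\<And>n. Y n \<in> K" "\<And>n. (norm (x - Y n))\<^sup>2 < d + inverse (real (Suc n))"
    by metis
  have close: "(norm (Y m - Y n))\<^sup>2 \<le> 2 * inverse (real (Suc m)) + 2 * inverse (real (Suc n))" for m n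
  proof -
    have "(norm ((x - Y m) + (x - Y n)))\<^sup>2 = 4 * (norm (x - (1/2) *\<^sub>R (Y m + Y n)))\<^sup>2"
    proof -
      have "(x - Y m) + (x - Y n) = 2 *\<^sub>R (x - (1/2) *\<^sub>R (Y m + Y n))"
        by (simp add: algebra_simps scaleR_2)
      then show ?thesis by (simp add: power_mult_distrib)
    qed
    moreover have "d \<le> (norm (x - (1/2) *\<^sub>R (Y m + Y n)))\<^sup>2"
      by (intro d_le KD Y)
    ultimately show ?thesis
      using parallelogram[of "x - Y m" "x - Y n"] Y(2)[of m] Y(2)[of n]
      by (simp add: norm_minus_commute)
  qed
  have "Cauchy Y"
  proof (rule metric_CauchyI)
    fix e :: real assume "0 < e"
    then obtain N where N: "inverse (real (Suc N)) < e\<^sup>2 / 4"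
      using reals_Archimedean[of "e\<^sup>2 / 4"] by auto
    have "dist (Y m) (Y n) < e" if "m \<ge> N" "n \<ge> N" for m n
    proof -
      have "inverse (real (Suc m)) \<le> inverse (real (Suc N))" "inverse (real (Suc n)) \<le> inverse (real (Suc N))"
        using that by auto
      then have "(norm (Y m - Y n))\<^sup>2 < e\<^sup>2" using close[of m n] N by linarith
      then show ?thesis using \<open>0 < e\<close> by (simp add: dist_norm power2_less_imp_less)
    qed
    then show "\<exists>M. \<forall>m\<ge>M. \<forall>n\<ge>M. dist (Y m) (Y n) < e" by blast
  qed
  then obtain p where p: "Y \<longlonglongrightarrow> p" using convergent_eq_Cauchy by blast
  have pK: "p \<in> K" using closed_sequentially[OF KD(1)] p Y(1) by blast
  have "(\<lambda>n. (norm (x - Y n))\<^sup>2) \<longlonglongrightarrow> (norm (x - p))\<^sup>2"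
    by (intro tendsto_intros p)
  moreover have "(\<lambda>n. d + inverse (real (Suc n))) \<longlonglongrightarrow> d + 0"
    by (intro tendsto_intros LIMSEQ_inverse_real_of_nat)
  ultimately have min: "(norm (x - p))\<^sup>2 \<le> d"
    using LIMSEQ_le[of "\<lambda>n. (norm (x - Y n))\<^sup>2" _ "\<lambda>n. d + inverse (real (Suc n))"] Y(2)
    by (simp add: less_imp_le)
  have "cinner (x - p) y = 0" if "y \<in> K" for y
  proof (cases "y = 0")
    case False
    define c where "c = cinner (x - p) y / (norm y)\<^sup>2"
    have "(norm (x - p))\<^sup>2 \<le> (norm (x - (p + c *\<^sub>C y)))\<^sup>2"
      using min d_le[OF KD(3)[OF pK KD(4)[OF that]], of c] by linarith
    also have "x - (p + c *\<^sub>C y) = (x - p) - c *\<^sub>C y" by simp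
    also have "(norm \<dots>)\<^sup>2 = (norm (x - p))\<^sup>2 - 2 * Re (cnj c * cinner (x - p) y) + (cmod c)\<^sup>2 * (norm y)\<^sup>2"
      by (simp add: norm_diff_sq[of "x - p"] cinner_scaleC_right norm_scaleC power_mult_distrib)
    also have "cnj c * cinner (x - p) y = complex_of_real ((cmod (cinner (x - p) y))\<^sup>2 / (norm y)\<^sup>2)"
      by (simp add: c_def complex_norm_square mult.commute del: of_real_power)
    also have "(cmod c)\<^sup>2 * (norm y)\<^sup>2 = (cmod (cinner (x - p) y))\<^sup>2 / (norm y)\<^sup>2"
      using False by (simp add: c_def norm_divide norm_mult power_divide power2_eq_square)
    finally have "(cmod (cinner (x - p) y))\<^sup>2 / (norm y)\<^sup>2 \<le> 0" by simp
    then show ?thesis using False by (simp add: divide_le_0_iff)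
  qed simp
  then show thesis using that pK by blast
qed

lemma bounded_clinear_onE:
  assumes "bounded_clinear_on K f"
  obtains B where "B > 0" "\<And>x. x \<in> K \<Longrightarrow> norm (f x) \<le> B * norm x"
proof -
  obtain B where B: "\<And>x. x \<in> K \<Longrightarrow> norm (f x) \<le> B * norm x"
    using assms unfolding bounded_clinear_on_def by blast
  have "norm (f x) \<le> max B 1 * norm x" if "x \<in> K" for x
    using B[OF that] mult_right_mono[of B "max B 1" "norm x"] by simp
  then show thesis using that[of "max B 1"] by simp
qed

lemma bounded_clinear_onI:
  assumes "\<And>x. x \<in> K \<Longrightarrow> f x \<in> K" "\<And>x y. x \<in> K \<Longrightarrow> y \<in> K \<Longrightarrow> f (x + y) = f x + f y"
    "\<And>c x. x \<in> K \<Longrightarrow> f (c *\<^sub>C x) = c *\<^sub>C f x" "\<And>x. x \<in> K \<Longrightarrow> norm (f x) \<le> B * norm x"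
  shows "bounded_clinear_on K f"
  using assms unfolding bounded_clinear_on_def by blast

lemma bounded_clinear_onD:
  assumes "bounded_clinear_on K f"
  shows "x \<in> K \<Longrightarrow> f x \<in> K" "x \<in> K \<Longrightarrow> y \<in> K \<Longrightarrow> f (x + y) = f x + f y"
    "x \<in> K \<Longrightarrow> f (c *\<^sub>C x) = c *\<^sub>C f x"
  using assms unfolding bounded_clinear_on_def by blast+

lemma bounded_clinear_on_more:
  assumes f: "bounded_clinear_on K f" and K: "closed_csubspace K"
  shows "f 0 = 0" "x \<in> K \<Longrightarrow> f (r *\<^sub>R x) = r *\<^sub>R f x" "x \<in> K \<Longrightarrow> f (- x) = - f x"
    "x \<in> K \<Longrightarrow> y \<in> K \<Longrightarrow> f (x - y) = f x - f y"
proof -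
  note KD = closed_csubspaceD[OF K] and fD = bounded_clinear_onD[OF f]
  show "f 0 = 0" using fD(3)[OF KD(2), of 0] by simp
  show r: "x \<in> K \<Longrightarrow> f (r *\<^sub>R x) = r *\<^sub>R f x" for x r using fD(3)[of x "complex_of_real r"] by (simp add: scaleC_of_real)
  show m: "x \<in> K \<Longrightarrow> f (- x) = - f x" for x using r[of x "-1"] by simp
  show "x \<in> K \<Longrightarrow> y \<in> K \<Longrightarrow> f (x - y) = f x - f y"
    using fD(2)[of x "-y"] m[of y] KD(6)[of y] by simp
qed

lemma bounded_clinear_on_continuous:
  assumes f: "bounded_clinear_on K f" and K: "closed_csubspace K"
    and X: "\<And>n. X n \<in> K" "X \<longlonglongrightarrow> x"
  shows "(\<lambda>n. f (X n)) \<longlonglongrightarrow> f x"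
proof -
  note KD = closed_csubspaceD[OF K]
  have x: "x \<in> K" using closed_sequentially[OF KD(1)] X by blast
  obtain B where B: "\<And>x. x \<in> K \<Longrightarrow> norm (f x) \<le> B * norm x"
    using bounded_clinear_onE[OF f] by metis
  have "(\<lambda>n. B * norm (X n - x)) \<longlonglongrightarrow> B * 0"
    using X(2) by (intro tendsto_intros tendsto_norm_zero) (simp add: LIM_zero)
  then have *: "(\<lambda>n. B * norm (X n - x)) \<longlonglongrightarrow> 0" by simp
  have "norm (f (X n) - f x) \<le> B * norm (X n - x)" for n
    using B[OF KD(7)[OF X(1) x]] bounded_clinear_on_more(4)[OF f K X(1) x] by metis
  then have "\<forall>\<^sub>F n in sequentially. norm (f (X n) - f x) \<le> B * norm (X n - x)" by simp
  then have "(\<lambda>n. f (X n) - f x) \<longlonglongrightarrow> 0"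
    using * by (rule Lim_null_comparison)
  then show ?thesis by (rule LIM_zero_cancel)
qed

lemma closed_csubspace_UNIV: "closed_csubspace (UNIV :: 'a::chilbert_space set)"
  by (simp add: closed_csubspace_def)

lemma closed_csubspace_kernel:
  fixes f :: "'a::chilbert_space \<Rightarrow> 'b::chilbert_space"
  assumes add: "\<And>x y. f (x + y) = f x + f y" and scale: "\<And>c x. f (c *\<^sub>C x) = c *\<^sub>C f x"
    and bdd: "\<And>x. norm (f x) \<le> B * norm x"
  shows "closed_csubspace {x. f x = 0}"
proof -
  have "bounded_linear f"
    by (rule bounded_linear_intro[of _ B])
       (use add scale bdd in \<open>auto simp: scaleC_of_real[symmetric] mult.commute\<close>)
  then have "continuous_on UNIV f" by (simp add: linear_continuous_on)
  then have "closed {x. f x = 0}"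
    using continuous_closed_preimage_constant[of UNIV f 0] by simp
  moreover have "f 0 = 0" using scale[of 0 0] by simp
  ultimately show ?thesis by (simp add: closed_csubspace_def add scale)
qed

text \<open>Off the trivial case, a vector normal to the kernel represents the functional up to a factor.\<close>
lemma Riesz_representation:
  fixes \<phi> :: "'a::chilbert_space \<Rightarrow> complex"
  assumes add: "\<And>x y. \<phi> (x + y) = \<phi> x + \<phi> y" and scale: "\<And>c x. \<phi> (c *\<^sub>C x) = c * \<phi> x"
    and bdd: "\<And>x. cmod (\<phi> x) \<le> B * norm x"
  obtains y where "\<And>x. \<phi> x = cinner x y"
proof (cases "\<forall>x. \<phi> x = 0")
  case True then show thesis using that[of 0] by simp
next
  case False
  then obtain x0 where x0: "\<phi> x0 \<noteq> 0" by blast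
  have ker: "closed_csubspace {x. \<phi> x = 0}"
    by (rule closed_csubspace_kernel[of _ B]) (auto simp: add scale bdd scaleC_complex_def)
  have diff: "\<phi> (x - y) = \<phi> x - \<phi> y" for x y
    using add[of x "-y"] scale[of "-1" y] by (simp add: uminus_eq_scaleC[of y, symmetric])
  obtain p where p: "\<phi> p = 0" "\<And>y. \<phi> y = 0 \<Longrightarrow> cinner (x0 - p) y = 0"
    using orthogonal_projection_exists[OF ker, of x0] by auto
  define u where "u = x0 - p"
  have u: "\<phi> u \<noteq> 0" using x0 p(1) by (simp add: u_def diff)
  then have u0: "u \<noteq> 0" using scale[of 0 0] by auto
  have "\<phi> x = cinner x ((cnj (\<phi> u) / (norm u)\<^sup>2) *\<^sub>C u)" for x
  proof -
    have "\<phi> (x - (\<phi> x / \<phi> u) *\<^sub>C u) = 0" using u by (simp add: diff scale)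
    then have "cinner u (x - (\<phi> x / \<phi> u) *\<^sub>C u) = 0" using p(2) u_def by blast
    then have "cinner (x - (\<phi> x / \<phi> u) *\<^sub>C u) u = 0"
      using cinner_commute[of "x - (\<phi> x / \<phi> u) *\<^sub>C u" u] by simp
    then have "cinner x u = (\<phi> x / \<phi> u) * (norm u)\<^sup>2"
      by (simp add: cinner_algebra cinner_self)
    then show ?thesis using u u0 by (simp add: cinner_scaleC_right)
  qed
  then show thesis using that by blast
qed

lemma cadjoint:
  fixes T :: "'h::chilbert_space \<Rightarrow> 'h"
  assumes T: "bounded_clinear_on UNIV T"
  shows "cinner (T x) y = cinner x (cadjoint T y)"
proof -
  obtain B where B: "\<And>x. norm (T x) \<le> B * norm x"
    using bounded_clinear_onE[OF T] UNIV_I by metis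
  have "\<exists>z. \<forall>x. cinner (T x) y = cinner x z" for y
  proof -
    have "cmod (cinner (T x) y) \<le> (B * norm y) * norm x" for x
      using Cauchy_Schwarz_cinner[of "T x" y] mult_right_mono[OF B[of x], of "norm y"]
      by (simp add: mult_ac)
    moreover have "cinner (T (x + x')) y = cinner (T x) y + cinner (T x') y"
      "cinner (T (c *\<^sub>C x)) y = c * cinner (T x) y" for x x' c
      using bounded_clinear_onD[OF T] by (simp_all add: cinner_algebra)
    ultimately show ?thesis
      using Riesz_representation[of "\<lambda>x. cinner (T x) y" "B * norm y"] by metis
  qed
  then obtain T' where T': "\<forall>x y. cinner (T x) y = cinner x (T' y)" by metis
  have "T'' = T'" if "\<forall>x y. cinner (T x) y = cinner x (T'' y)" for T''
  proof
    fix y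
    have "cinner (T'' y - T' y) x = 0" for x
    proof -
      have "cinner x (T'' y) = cinner x (T' y)" using that T' by metis
      then have "cinner x (T'' y - T' y) = 0" by (simp add: cinner_diff_right)
      then show ?thesis using cinner_commute[of "T'' y - T' y" x] by simp
    qed
    then show "T'' y = T' y" using cinner_eq_0_imp[of "T'' y - T' y"] by simp
  qed
  then have "cadjoint T = T'" unfolding cadjoint_def using T' by (intro the_equality) auto
  then show ?thesis using T' by simp
qed

lemma norm_cadjoint_le:
  fixes T :: "'h::chilbert_space \<Rightarrow> 'h"
  assumes T: "bounded_clinear_on UNIV T" and B: "\<And>x. norm (T x) \<le> B * norm x" and "0 \<le> B"
  shows "norm (cadjoint T y) \<le> B * norm y"
proof -
  let ?z = "cadjoint T y"
  have "(norm ?z)\<^sup>2 = Re (cinner (T ?z) y)" by (simp add: cadjoint[OF T] norm_sq_cinner)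
  also have "\<dots> \<le> (B * norm ?z) * norm y"
    using Re_cinner_le[of "T ?z" y] mult_right_mono[OF B[of ?z], of "norm y"] by simp
  finally have "norm ?z * norm ?z \<le> norm ?z * (B * norm y)" by (simp add: power2_eq_square mult_ac)
  moreover have "0 \<le> B * norm y" using \<open>0 \<le> B\<close> by simp
  ultimately show ?thesis by (cases "?z = 0") (auto simp: mult_le_cancel_left)
qed

section \<open>Operators with an A-adjoint are bounded for the A-seminorm\<close>

text \<open>By Baire's theorem one of the closed sets of vectors at which the whole family is bounded by
  \<^term>\<open>n\<close> contains a ball.\<close>
lemma weakly_bounded_imp_bounded:
  fixes V :: "'a::chilbert_space set"
  assumes wb: "\<And>y. \<exists>B. \<forall>v\<in>V. cmod (cinner v y) \<le> B"
  obtains C where "C > 0" "\<And>v. v \<in> V \<Longrightarrow> norm v \<le> C"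
proof -
  define F where "F n = {y. \<forall>v\<in>V. cmod (cinner v y) \<le> real n}" for n
  have cont: "continuous_on UNIV (\<lambda>y. cmod (cinner v y))" for v :: 'a
    by (intro continuous_intros bounded_bilinear.continuous_on[OF bounded_bilinear_cinner])
  have "F n = (\<Inter>v\<in>V. {y. cmod (cinner v y) \<le> real n})" for n
    by (auto simp: F_def)
  then have closed: "closed (F n)" for n
    using closed_Collect_le[OF cont continuous_on_const] by (simp add: closed_INT)
  have "\<exists>n. interior (F n) \<noteq> {}"
  proof (rule ccontr)
    assume "\<not> ?thesis"
    then have "euclidean interior_of \<Union>(range F) = {}"
      using closed
      by (intro Baire_category_alt) (auto simp: completely_metrizable_space_euclidean)
    moreover have "\<Union>(range F) = UNIV"
    proof -
      have "\<exists>n. y \<in> F n" for y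
      proof -
        obtain B where B: "\<forall>v\<in>V. cmod (cinner v y) \<le> B" using wb by blast
        obtain n where "B \<le> real n" using real_arch_simple by blast
        then show ?thesis using B unfolding F_def mem_Collect_eq by (meson order_trans)
      qed
      then show ?thesis by blast
    qed
    ultimately show False by simp
  qed
  then obtain n y0 where "y0 \<in> interior (F n)" by blast
  then obtain e where e: "e > 0" "ball y0 e \<subseteq> F n"
    using mem_interior by blast
  have "norm v \<le> 4 * real n / e" if "v \<in> V" for v
  proof (cases "v = 0")
    case False
    define y where "y = y0 + (e / (2 * norm v)) *\<^sub>R v"
    have "y \<in> ball y0 e" using e False by (simp add: y_def dist_norm)
    then have "cmod (cinner v y) \<le> n" "cmod (cinner v y0) \<le> n"
      using e that by (auto simp: F_def subset_eq)
    moreover have "cinner v y - cinner v y0 = complex_of_real (e * norm v / 2)"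
      using False by (simp add: y_def cinner_add_right cinner_scaleR_right cinner_self power2_eq_square scaleR_conv_of_real)
    then have "cmod (cinner v y - cinner v y0) = e * norm v / 2"
      using e by (metis norm_of_real abs_of_nonneg divide_nonneg_nonneg mult_nonneg_nonneg norm_ge_zero less_imp_le zero_le_numeral)
    ultimately have "e * norm v / 2 \<le> 2 * n"
      using norm_triangle_ineq4[of "cinner v y" "cinner v y0"] by linarith
    then show ?thesis using e by (simp add: field_simps)
  qed (use e in simp)
  then show thesis using that[of "4 * real n / e + 1"] e
    by (smt (verit) divide_nonneg_pos of_nat_0_le_iff)
qed

text \<open>Log-convexity makes the ratios \<^term>\<open>b (Suc n) / b n\<close> increase, so geometric growth of the
  sequence already bounds the first ratio.\<close>
lemma log_convex_growth:
  fixes b :: "nat \<Rightarrow> real"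
  assumes nonneg: "\<And>n. 0 \<le> b n" and conv: "\<And>n. (b (Suc n))\<^sup>2 \<le> b n * b (Suc (Suc n))"
    and growth: "\<And>n. b n \<le> M ^ n * D" and M: "M > 0"
  shows "b 1 \<le> M * b 0"
proof (rule ccontr)
  assume *: "\<not> b 1 \<le> M * b 0"
  have "b 0 \<noteq> 0" using conv[of 0] * by auto
  then have b0: "b 0 > 0" using nonneg[of 0] by simp
  define \<rho> where "\<rho> = b 1 / b 0"
  have \<rho>: "\<rho> > M" using * b0 by (simp add: \<rho>_def field_simps)
  have ratio: "b n > 0 \<and> \<rho> * b n \<le> b (Suc n)" for n
  proof (induction n)
    case 0 then show ?case using b0 by (simp add: \<rho>_def)
  next
    case (Suc n)
    then have pos: "b (Suc n) > 0" using \<rho> M by (smt (verit) mult_pos_pos)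
    have "\<rho> * b n * b (Suc n) \<le> (b (Suc n))\<^sup>2"
      using Suc pos by (simp add: power2_eq_square)
    also have "\<dots> \<le> b n * b (Suc (Suc n))" by (rule conv)
    finally have "b n * (\<rho> * b (Suc n)) \<le> b n * b (Suc (Suc n))" by (simp add: mult_ac)
    then show ?case using Suc pos by simp
  qed
  have "\<rho> ^ n * b 0 \<le> b n" for n
  proof (induction n)
    case (Suc n)
    have "\<rho> * (\<rho> ^ n * b 0) \<le> \<rho> * b n" using Suc \<rho> M by simp
    then show ?case using ratio[of n] by (simp add: mult_ac)
  qed simp
  then have "\<rho> ^ n * b 0 \<le> M ^ n * D" for n using growth order_trans by blast
  then have bound: "(\<rho> / M) ^ n \<le> D / b 0" for n
    using b0 M by (simp add: power_divide field_simps)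
  have "\<rho> / M > 1" using \<rho> M by simp
  then obtain n where "D / b 0 < (\<rho> / M) ^ n" using real_arch_pow by blast
  then show False using bound[of n] by simp
qed

text \<open>The map \<^term>\<open>J\<close> carries the whole A-structure: A-inner products are inner products of images
  under \<^term>\<open>J\<close>.  Working with images identifies vectors that differ by an element of the
  kernel of \<^term>\<open>A\<close>, which the seminorm cannot tell apart.\<close>
locale A_completed =
  fixes A :: "'h::chilbert_space \<Rightarrow> 'h" and K :: "'k::chilbert_space set" and J :: "'h \<Rightarrow> 'k"
  assumes A: "bounded_clinear_on UNIV A" and completion: "A_completion A K J"
begin

lemma J_add: "J (x + y) = J x + J y" and J_scaleC: "J (c *\<^sub>C x) = c *\<^sub>C J x"
  and cinner_J: "cinner (J x) (J y) = cinner (A x) y" and K_eq: "K = closure (range J)"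
  using completion by (auto simp: A_completion_def A_inner_def)

lemma J_diff: "J (x - y) = J x - J y"
  using J_add[of x "-y"] J_scaleC[of "-1" y] by (simp add: uminus_eq_scaleC[symmetric])

lemma A_linear: "A (x + y) = A x + A y" "A (c *\<^sub>C x) = c *\<^sub>C A x"
  "A (x - y) = A x - A y" "A (r *\<^sub>R x) = r *\<^sub>R A x" "A 0 = 0"
  using bounded_clinear_onD[OF A] bounded_clinear_on_more[OF A closed_csubspace_UNIV] by simp_all

lemma A_selfadjoint: "cinner (A x) y = cinner x (A y)"
  by (metis cinner_J cinner_commute)

lemma A_inner_J: "A_inner A x y = cinner (J x) (J y)"
  by (simp add: A_inner_def cinner_J)

lemma A_norm_J: "A_norm A x = norm (J x)"
  by (simp add: A_norm_def A_inner_J cinner_self)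

text \<open>On the range of \<^term>\<open>A\<close> the Moore-Penrose inverse selects the preimage orthogonal to the
  kernel, which exists by projecting any preimage.\<close>
lemma A_moore_penrose:
  assumes "y \<in> range A" shows "A (moore_penrose A y) = y"
proof -
  obtain z where z: "y = A z" using assms by blast
  obtain B where B: "\<And>x. norm (A x) \<le> B * norm x"
    using bounded_clinear_onE[OF A] UNIV_I by metis
  have "closed_csubspace {x. A x = 0}"
    by (rule closed_csubspace_kernel[of _ B]) (auto simp: A_linear B)
  then obtain p where p: "A p = 0" "\<And>w. A w = 0 \<Longrightarrow> cinner (z - p) w = 0"
    using orthogonal_projection_exists[of "{x. A x = 0}" z] by auto
  have "moore_penrose A y = z - p"
    unfolding moore_penrose_def
  proof (rule the_equality)
    show "z - p \<in> ortho_compl {z. A z = 0} \<and> y - A (z - p) \<in> ortho_compl (range A)"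
      using p z by (auto simp: ortho_compl_def A_linear)
  next
    fix x assume x: "x \<in> ortho_compl {z. A z = 0} \<and> y - A x \<in> ortho_compl (range A)"
    have "y - A x = A (z - x)" by (simp add: z A_linear)
    then have "cinner (y - A x) (y - A x) = 0" using x unfolding ortho_compl_def by force
    then have "y - A x = 0" by (simp add: cinner_self)
    then have "A (x - (z - p)) = 0" using z p(1) by (simp add: A_linear)
    then have "cinner (x - (z - p)) (x - (z - p)) = 0"
      using x p(2) by (simp add: ortho_compl_def cinner_diff_left[of x])
    then show "x = z - p" by (simp add: cinner_self)
  qed
  then show ?thesis using p(1) z by (simp add: A_linear)
qed

lemma A_A_adjoint:
  assumes T: "T \<in> A_adjointable A" shows "A (A_adjoint A T x) = cadjoint T (A x)"
  using assms A_moore_penrose[of "cadjoint T (A x)"]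
  by (force simp: A_adjointable_def A_adjoint_def)

lemma cinner_J_A_adjoint:
  assumes T: "T \<in> A_adjointable A"
  shows "cinner (J x) (J (A_adjoint A T y)) = cinner (J (T x)) (J y)"
proof -
  have "bounded_clinear_on UNIV T" using T by (simp add: A_adjointable_def)
  then show ?thesis
    by (simp add: cinner_J A_selfadjoint A_A_adjoint[OF T] cadjoint)
qed

lemma cinner_A_adjoint_J:
  assumes T: "T \<in> A_adjointable A"
  shows "cinner (J (A_adjoint A T x)) (J y) = cinner (J x) (J (T y))"
  using cinner_J_A_adjoint[OF T, of y x] by (metis cinner_commute)

text \<open>The range inclusion enters through the existence of the A-adjoint: for fixed \<^term>\<open>y\<close> the inner product of
  \<^term>\<open>A (T z)\<close> with \<^term>\<open>y\<close> is that of \<^term>\<open>A z\<close> with the A-adjoint of \<^term>\<open>T\<close> at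
  \<^term>\<open>y\<close>, so the vectors \<^term>\<open>A (T z)\<close> with \<^term>\<open>norm (A z) \<le> 1\<close> are weakly bounded.\<close>
lemma norm_A_T_le:
  assumes T: "T \<in> A_adjointable A"
  obtains C where "C > 0" "\<And>z. norm (A (T z)) \<le> C * norm (A z)"
proof -
  have Tb: "bounded_clinear_on UNIV T" using T by (simp add: A_adjointable_def)
  have "\<exists>B. \<forall>v\<in>{A (T z) |z. norm (A z) \<le> 1}. cmod (cinner v y) \<le> B" for y
  proof (intro exI ballI)
    fix v assume "v \<in> {A (T z) |z. norm (A z) \<le> 1}"
    then obtain z where z: "v = A (T z)" "norm (A z) \<le> 1" by blast
    have "cinner v y = cinner (A z) (A_adjoint A T y)"
      using cinner_J_A_adjoint[OF T, of z y] by (simp add: cinner_J z)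
    then show "cmod (cinner v y) \<le> norm (A_adjoint A T y)"
      using Cauchy_Schwarz_cinner[of "A z" "A_adjoint A T y"]
        mult_right_mono[OF z(2), of "norm (A_adjoint A T y)"] by simp
  qed
  then obtain C where C: "C > 0" "\<And>v. v \<in> {A (T z) |z. norm (A z) \<le> 1} \<Longrightarrow> norm v \<le> C"
    by (rule weakly_bounded_imp_bounded) blast
  have "norm (A (T z)) \<le> C * norm (A z)" for z
  proof (rule ccontr)
    assume *: "\<not> ?thesis"
    \<comment> \<open>Scaling by slightly more than \<open>norm (A z)\<close> also covers \<open>A z = 0\<close>.\<close>
    define t where "t = norm (A (T z)) / C"
    have t: "norm (A z) < t" "t > 0"
      using * C(1) by (auto simp: t_def field_simps)
    obtain t' where t': "norm (A z) < t'" "t' < t" using t(1) dense by blast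
    then have "t' > 0" by (smt (verit) norm_ge_zero)
    have "norm (A ((1/t') *\<^sub>R z)) \<le> 1" using t' \<open>t' > 0\<close> by (simp add: A_linear)
    then have "norm (A (T ((1/t') *\<^sub>R z))) \<le> C" using C(2) by blast
    then have "norm (A (T z)) \<le> C * t'"
      using \<open>t' > 0\<close> bounded_clinear_on_more(2)[OF Tb closed_csubspace_UNIV]
      by (simp add: A_linear field_simps)
    then show False using t'(2) C(1) by (simp add: t_def field_simps)
  qed
  then show thesis using that C(1) by blast
qed

text \<open>Krein's argument for symmetrisable operators: the A-norms of the iterates of an A-symmetric
  operator are log-convex, and \<^term>\<open>(norm (J ((P ^^ n) x)))\<^sup>2\<close> is the inner product of
  \<^term>\<open>A ((P ^^ (2 * n)) x)\<close> with \<^term>\<open>x\<close>, which grows at most geometrically.\<close>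
lemma Krein_bound:
  assumes sym: "\<And>x y. cinner (J (P x)) (J y) = cinner (J x) (J (P y))"
    and bd: "\<And>x. norm (A (P x)) \<le> M * norm (A x)" and M: "M > 0"
  shows "norm (J (P x)) \<le> M * norm (J x)"
proof -
  define b where "b n = norm (J ((P ^^ n) x))" for n
  have symn: "cinner (J ((P ^^ n) u)) (J v) = cinner (J u) (J ((P ^^ n) v))" for n u v
    by (induction n arbitrary: u) (simp_all del: funpow.simps(2) add: funpow_Suc_right sym funpow_swap1)
  have An: "norm (A ((P ^^ n) u)) \<le> M ^ n * norm (A u)" for n u
  proof (induction n)
    case (Suc n)
    have "norm (A ((P ^^ Suc n) u)) \<le> M * norm (A ((P ^^ n) u))" by (simp add: bd)
    also have "\<dots> \<le> M * (M ^ n * norm (A u))" using Suc M by simp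
    finally show ?case by (simp add: mult_ac)
  qed simp
  define D where "D = sqrt (norm (A x) * norm x)"
  have "b 1 \<le> M * b 0"
  proof (rule log_convex_growth)
    show "(b (Suc n))\<^sup>2 \<le> b n * b (Suc (Suc n))" for n
    proof -
      have "(b (Suc n))\<^sup>2 = Re (cinner (J ((P ^^ n) x)) (J ((P ^^ Suc (Suc n)) x)))"
        unfolding b_def norm_sq_cinner using sym[of "(P ^^ n) x"] by simp
      also have "\<dots> \<le> b n * b (Suc (Suc n))" unfolding b_def by (rule Re_cinner_le)
      finally show ?thesis .
    qed
    show "b n \<le> M ^ n * D" for n
    proof (rule power2_le_imp_le)
      have "(b n)\<^sup>2 = Re (cinner (J ((P ^^ n) ((P ^^ n) x))) (J x))"
        unfolding b_def norm_sq_cinner by (simp add: symn)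
      also have "\<dots> = Re (cinner (A ((P ^^ (n + n)) x)) x)"
        by (simp add: cinner_J funpow_add)
      also have "\<dots> \<le> norm (A ((P ^^ (n + n)) x)) * norm x" by (rule Re_cinner_le)
      also have "\<dots> \<le> (M ^ (n + n) * norm (A x)) * norm x"
        by (intro mult_right_mono An) simp
      also have "\<dots> = (M ^ n * D)\<^sup>2"
        by (simp add: D_def power_mult_distrib power_add power2_eq_square)
      finally show "(b n)\<^sup>2 \<le> (M ^ n * D)\<^sup>2" .
      show "0 \<le> M ^ n * D" using M by (simp add: D_def)
    qed
  qed (use M in \<open>simp_all add: b_def\<close>)
  then show ?thesis by (simp add: b_def)
qed

text \<open>Boundedness of \<open>z \<mapsto> A (T z)\<close> relative to \<^term>\<open>A\<close>, followed by the adjoint of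
  \<^term>\<open>T\<close>, puts the composition within reach of Krein's argument.\<close>
lemma A_adjoint_compose_bound:
  assumes T: "T \<in> A_adjointable A"
  obtains M where "M > 0" "\<And>x. norm (J (A_adjoint A T (T x))) \<le> M * norm (J x)"
proof -
  have Tb: "bounded_clinear_on UNIV T" using T by (simp add: A_adjointable_def)
  obtain B where B: "B > 0" "\<And>x. norm (T x) \<le> B * norm x"
    using bounded_clinear_onE[OF Tb] UNIV_I by metis
  obtain C where C: "C > 0" "\<And>z. norm (A (T z)) \<le> C * norm (A z)"
    using norm_A_T_le[OF T] by blast
  have "norm (J (A_adjoint A T (T x))) \<le> (B * C) * norm (J x)" for x
  proof (rule Krein_bound[of "\<lambda>x. A_adjoint A T (T x)"])
    show "cinner (J (A_adjoint A T (T x))) (J y) = cinner (J x) (J (A_adjoint A T (T y)))" for x y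
      by (simp add: cinner_A_adjoint_J[OF T] cinner_J_A_adjoint[OF T])
    show "norm (A (A_adjoint A T (T z))) \<le> B * C * norm (A z)" for z
    proof -
      have "norm (A (A_adjoint A T (T z))) \<le> B * norm (A (T z))"
        by (simp add: A_A_adjoint[OF T] norm_cadjoint_le[OF Tb B(2)] B(1) less_imp_le)
      also have "\<dots> \<le> B * (C * norm (A z))" using B C by simp
      finally show ?thesis by (simp add: mult_ac)
    qed
  qed (use B C in simp)
  then show thesis using that[of "B * C"] B C by simp
qed

end

section \<open>Polynomials of an operator on a closed subspace\<close>

definition invertible_on :: "'a::chilbert_space set \<Rightarrow> ('a \<Rightarrow> 'a) \<Rightarrow> bool" where
  "invertible_on K h \<longleftrightarrow> (\<exists>g. bounded_clinear_on K g \<and> (\<forall>x\<in>K. g (h x) = x \<and> h (g x) = x))"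

lemma spectrum_on_iff: "z \<in> spectrum_on K f \<longleftrightarrow> \<not> invertible_on K (\<lambda>x. f x - z *\<^sub>C x)"
  by (simp add: spectrum_on_def invertible_on_def)

lemma invertible_on_compose:
  assumes h: "invertible_on K h" "invertible_on K k" and maps: "\<And>x. x \<in> K \<Longrightarrow> k x \<in> K"
    and eq: "\<And>x. x \<in> K \<Longrightarrow> l x = h (k x)"
  shows "invertible_on K l"
proof -
  obtain g where g: "bounded_clinear_on K g" "\<And>x. x \<in> K \<Longrightarrow> g (h x) = x" "\<And>x. x \<in> K \<Longrightarrow> h (g x) = x"
    using h(1) unfolding invertible_on_def by metis
  obtain g' where g': "bounded_clinear_on K g'" "\<And>x. x \<in> K \<Longrightarrow> g' (k x) = x" "\<And>x. x \<in> K \<Longrightarrow> k (g' x) = x"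
    using h(2) unfolding invertible_on_def by metis
  obtain B where B: "B > 0" "\<And>x. x \<in> K \<Longrightarrow> norm (g x) \<le> B * norm x"
    using bounded_clinear_onE[OF g(1)] by metis
  obtain B' where B': "B' > 0" "\<And>x. x \<in> K \<Longrightarrow> norm (g' x) \<le> B' * norm x"
    using bounded_clinear_onE[OF g'(1)] by metis
  note gD = bounded_clinear_onD[OF g(1)] and gD' = bounded_clinear_onD[OF g'(1)]
  have "bounded_clinear_on K (\<lambda>x. g' (g x))"
  proof (rule bounded_clinear_onI)
    show "norm (g' (g x)) \<le> (B' * B) * norm x" if "x \<in> K" for x
      using order_trans[OF B'(2)[OF gD(1)[OF that]] mult_left_mono[OF B(2)[OF that], of B']] B'(1)
      by (simp add: mult.assoc)
  qed (simp_all add: gD gD')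
  then show ?thesis
    unfolding invertible_on_def
    by (intro exI[of _ "\<lambda>x. g' (g x)"]) (simp add: eq g g' gD gD' maps)
qed

locale operator_on =
  fixes K :: "'a::chilbert_space set" and f :: "'a \<Rightarrow> 'a"
  assumes K: "closed_csubspace K" and f: "bounded_clinear_on K f"
begin

lemmas KD = closed_csubspaceD[OF K]
lemmas fD = bounded_clinear_onD[OF f] bounded_clinear_on_more[OF f K]

lemma funpow_in: "x \<in> K \<Longrightarrow> (f ^^ n) x \<in> K"
  by (induction n) (simp_all add: fD)

lemma partial_sum_in:
  assumes "x \<in> K" shows "(\<Sum>i\<le>n. c i *\<^sub>C (f ^^ i) x) \<in> K"
  by (induction n) (simp_all add: assms KD fD funpow_in del: funpow.simps(2))

lemma op_poly_in: "x \<in> K \<Longrightarrow> op_poly p f x \<in> K"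
  unfolding op_poly_def by (rule partial_sum_in)

lemma f_partial_sum:
  assumes "x \<in> K"
  shows "f (\<Sum>i\<le>n. c i *\<^sub>C (f ^^ i) x) = (\<Sum>i\<le>n. c i *\<^sub>C (f ^^ Suc i) x)"
proof (induction n)
  case (Suc n)
  then show ?case
    using partial_sum_in[OF assms, of c n] funpow_in[OF assms] by (simp add: fD KD)
qed (simp add: fD assms)

lemma op_poly_0: "op_poly 0 f x = 0"
  by (simp add: op_poly_def)

lemma op_poly_pCons:
  assumes "x \<in> K"
  shows "op_poly (pCons a p) f x = a *\<^sub>C x + f (op_poly p f x)"
proof (cases "p = 0")
  case True
  then show ?thesis by (simp add: op_poly_def fD)
next
  case False
  have "op_poly (pCons a p) f x = (\<Sum>i\<le>Suc (degree p). coeff (pCons a p) i *\<^sub>C (f ^^ i) x)"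
    using False by (simp add: op_poly_def)
  also have "\<dots> = a *\<^sub>C x + (\<Sum>i\<le>degree p. coeff p i *\<^sub>C (f ^^ Suc i) x)"
    by (simp only: sum.atMost_Suc_shift coeff_pCons_0 coeff_pCons_Suc funpow_0)
  finally show ?thesis
    by (simp only: op_poly_def f_partial_sum[OF assms])
qed

lemma op_poly_const: "x \<in> K \<Longrightarrow> op_poly [:c:] f x = c *\<^sub>C x"
  by (simp add: op_poly_pCons op_poly_0 fD)

lemma op_poly_add:
  assumes "x \<in> K" shows "op_poly (p + q) f x = op_poly p f x + op_poly q f x"
proof (induction p q rule: poly_induct2)
  case (pCons a p b q)
  then show ?case
    by (simp add: op_poly_pCons assms fD op_poly_in scaleC_add_left)
qed (simp add: op_poly_0)

lemma op_poly_smult: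
  assumes "x \<in> K" shows "op_poly (smult c p) f x = c *\<^sub>C op_poly p f x"
  by (induction p) (simp_all add: op_poly_0 op_poly_pCons assms fD op_poly_in scaleC_add_right scaleC_scaleC)

lemma op_poly_diff:
  assumes "x \<in> K" shows "op_poly (p - q) f x = op_poly p f x - op_poly q f x"
  using op_poly_add[OF assms, of p "smult (-1) q"] op_poly_smult[OF assms, of "-1" q]
  by (simp add: scaleC_minus_left)

lemma op_poly_mult:
  assumes "x \<in> K" shows "op_poly (p * q) f x = op_poly p f (op_poly q f x)"
  by (induction p)
    (simp_all add: op_poly_0 op_poly_pCons op_poly_add op_poly_smult assms op_poly_in)

lemma op_poly_bounded_clinear: "bounded_clinear_on K (op_poly p f)"
proof -
  have "\<exists>B. \<forall>x\<in>K. norm (op_poly p f x) \<le> B * norm x"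
  proof (induction p)
    case (pCons a p)
    obtain B where B: "\<And>x. x \<in> K \<Longrightarrow> norm (op_poly p f x) \<le> B * norm x" using pCons by blast
    obtain C where C: "C > 0" "\<And>x. x \<in> K \<Longrightarrow> norm (f x) \<le> C * norm x"
      using bounded_clinear_onE[OF f] by metis
    have "norm (op_poly (pCons a p) f x) \<le> (cmod a + C * B) * norm x" if "x \<in> K" for x
    proof -
      have "norm (op_poly (pCons a p) f x) \<le> norm (a *\<^sub>C x) + norm (f (op_poly p f x))"
        unfolding op_poly_pCons[OF that] by (rule norm_triangle_ineq)
      also have "\<dots> \<le> cmod a * norm x + C * norm (op_poly p f x)"
        using C(2)[OF op_poly_in[OF that]] by (simp add: norm_scaleC)
      also have "\<dots> \<le> cmod a * norm x + C * (B * norm x)"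
        using B[OF that] C(1) by simp
      finally show ?thesis by (simp add: algebra_simps)
    qed
    then show ?case by blast
  qed (intro exI[of _ 0], simp add: op_poly_0)
  moreover have "op_poly p f (x + y) = op_poly p f x + op_poly p f y" if "x \<in> K" "y \<in> K" for x y
    using that
    by (induction p) (simp_all add: op_poly_0 op_poly_pCons op_poly_in KD fD scaleC_add_right)
  moreover have "op_poly p f (c *\<^sub>C x) = c *\<^sub>C op_poly p f x" if "x \<in> K" for c x
    using that
    by (induction p) (simp_all add: op_poly_0 op_poly_pCons op_poly_in KD fD scaleC_add_right scaleC_scaleC mult.commute)
  ultimately show ?thesis
    unfolding bounded_clinear_on_def using op_poly_in by blast
qed

text \<open>Over the complex numbers a polynomial splits into linear factors, so its value at \<^term>\<open>f\<close> is
  invertible unless one of its roots lies in the spectrum.\<close>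
lemma op_poly_invertible:
  assumes "p \<noteq> 0" "\<And>z. poly p z = 0 \<Longrightarrow> z \<notin> spectrum_on K f"
  shows "invertible_on K (op_poly p f)"
  using assms
proof (induction "degree p" arbitrary: p)
  case 0
  then obtain c where c: "p = [:c:]" "c \<noteq> 0" by (metis degree_eq_zeroE pCons_0_0)
  have "bounded_clinear_on K (\<lambda>x. inverse c *\<^sub>C x)"
    by (rule bounded_clinear_onI[where B = "cmod (inverse c)"])
      (simp_all add: KD scaleC_add_right scaleC_scaleC mult.commute norm_scaleC)
  then show ?case
    unfolding invertible_on_def
    by (intro exI[of _ "\<lambda>x. inverse c *\<^sub>C x"]) (simp add: c op_poly_const KD scaleC_scaleC)
next
  case (Suc n)
  have "\<not> constant (poly p)" using Suc(2) by (simp add: constant_degree)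
  then obtain z where z: "poly p z = 0" using fundamental_theorem_of_algebra by blast
  then obtain q where q: "p = [:- z, 1:] * q" by (metis dvdE poly_eq_0_iff_dvd)
  then have q0: "q \<noteq> 0" using Suc(3) by auto
  then have "degree p = Suc (degree q)" unfolding q by (subst degree_mult_eq) auto
  then have inv_q: "invertible_on K (op_poly q f)"
    using Suc(1)[of q] Suc(2) Suc(4) q0 by (simp add: q)
  have inv_z: "invertible_on K (\<lambda>x. f x - z *\<^sub>C x)"
    using Suc(4)[OF z] by (simp add: spectrum_on_iff)
  have "op_poly p f x = f (op_poly q f x) - z *\<^sub>C op_poly q f x" if "x \<in> K" for x
    using that op_poly_in[OF that, of q]
    by (simp only: q op_poly_mult) (simp add: op_poly_pCons op_poly_0 fD scaleC_minus_left)
  then show ?case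
    using invertible_on_compose[OF inv_z inv_q op_poly_in, of "op_poly p f"] by blast
qed

end

section \<open>Spectrum of a positive operator\<close>

text \<open>The range of \<^term>\<open>h\<close> is closed because \<^term>\<open>h\<close> is bounded below, and dense because its adjoint
  is injective.\<close>
lemma bounded_below_invertible:
  assumes K: "closed_csubspace K" and h: "bounded_clinear_on K h"
    and h': "\<And>x. x \<in> K \<Longrightarrow> h' x \<in> K"
    and adj: "\<And>x y. x \<in> K \<Longrightarrow> y \<in> K \<Longrightarrow> cinner (h x) y = cinner x (h' y)"
    and c: "c > 0" and below: "\<And>x. x \<in> K \<Longrightarrow> c * norm x \<le> norm (h x)"
    "\<And>x. x \<in> K \<Longrightarrow> c * norm x \<le> norm (h' x)"
  shows "invertible_on K h"
proof -
  note KD = closed_csubspaceD[OF K] and hD = bounded_clinear_onD[OF h] bounded_clinear_on_more[OF h K]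
  have inj: "inj_on h K"
  proof (rule inj_onI)
    fix x y assume xy: "x \<in> K" "y \<in> K" "h x = h y"
    then have "c * norm (x - y) \<le> 0" using below(1)[of "x - y"] by (simp add: KD hD)
    then show "x = y" using c by (simp add: mult_le_0_iff)
  qed
  have closed: "closed (h ` K)"
    unfolding closed_sequential_limits
  proof (intro allI impI, elim conjE)
    fix Y y assume Y: "\<forall>n. Y n \<in> h ` K" "Y \<longlonglongrightarrow> y"
    then have "\<forall>n. \<exists>x. x \<in> K \<and> Y n = h x" by blast
    then obtain X where X: "\<And>n. X n \<in> K" "\<And>n. Y n = h (X n)" by metis
    have "Cauchy Y" using Y(2) by (rule LIMSEQ_imp_Cauchy)
    have "Cauchy X"
    proof (rule metric_CauchyI)
      fix e :: real assume "e > 0"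
      then obtain N where N: "\<And>m n. m \<ge> N \<Longrightarrow> n \<ge> N \<Longrightarrow> dist (Y m) (Y n) < c * e"
        using metric_CauchyD[OF \<open>Cauchy Y\<close>, of "c * e"] c by auto
      have "dist (X m) (X n) < e" if "m \<ge> N" "n \<ge> N" for m n
      proof -
        have "c * dist (X m) (X n) \<le> dist (Y m) (Y n)"
          using below(1)[of "X m - X n"] by (simp add: X KD hD dist_norm)
        also have "\<dots> < c * e" using N that by blast
        finally show ?thesis using c by simp
      qed
      then show "\<exists>M. \<forall>m\<ge>M. \<forall>n\<ge>M. dist (X m) (X n) < e" by blast
    qed
    then obtain x where x: "X \<longlonglongrightarrow> x" using convergent_eq_Cauchy by blast
    then have "x \<in> K" using closed_sequentially[OF KD(1)] X(1) by blast
    moreover have "Y \<longlonglongrightarrow> h x"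
      using bounded_clinear_on_continuous[OF h K X(1) x] by (simp add: X(2)[symmetric])
    ultimately show "y \<in> h ` K" using Y(2) LIMSEQ_unique by blast
  qed
  have R: "closed_csubspace (h ` K)"
    unfolding closed_csubspace_def
  proof (intro conjI ballI allI closed)
    show "0 \<in> h ` K" using KD(2) hD(4) by (metis imageI)
    show "u + v \<in> h ` K" if "u \<in> h ` K" "v \<in> h ` K" for u v
      using that by (auto simp: hD(2)[symmetric] KD intro!: imageI)
    show "a *\<^sub>C u \<in> h ` K" if "u \<in> h ` K" for a u
      using that by (auto simp: hD(3)[symmetric] KD intro!: imageI)
  qed
  have surj: "h ` K = K"
  proof
    show "K \<subseteq> h ` K"
    proof
      fix u assume u: "u \<in> K"
      obtain p where p: "p \<in> h ` K" "\<And>y. y \<in> h ` K \<Longrightarrow> cinner (u - p) y = 0"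
        using orthogonal_projection_exists[OF R] by metis
      have up: "u - p \<in> K" using u p(1) hD(1) KD(7) by blast
      have "cinner (h (h' (u - p))) (u - p) = 0"
        using p(2)[of "h (h' (u - p))"] h'[OF up] cinner_commute[of "u - p"]
        by (metis complex_cnj_cancel_iff complex_cnj_zero imageI)
      then have "cinner (h' (u - p)) (h' (u - p)) = 0" using adj h' up by simp
      then have "norm (h' (u - p)) = 0" by (simp add: cinner_self)
      then have "c * norm (u - p) \<le> 0" using below(2)[OF up] by simp
      then have "u = p" using c by (simp add: mult_le_0_iff)
      then show "u \<in> h ` K" using p(1) by simp
    qed
  qed (use hD(1) in blast)
  define g where "g = inv_into K h"
  have gin: "g x \<in> K" and hg: "h (g x) = x" if "x \<in> K" for x
    using that surj inv_into_into[of x h K] f_inv_into_f[of x h K] by (auto simp: g_def)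
  have gh: "g (h x) = x" if "x \<in> K" for x using inv_into_f_f[OF inj that] by (simp add: g_def)
  have "bounded_clinear_on K g"
  proof (rule bounded_clinear_onI)
    show "g (x + y) = g x + g y" if "x \<in> K" "y \<in> K" for x y
      using gh[of "g x + g y"] that by (simp add: gin hg hD KD)
    show "g (a *\<^sub>C x) = a *\<^sub>C g x" if "x \<in> K" for a x
      using gh[of "a *\<^sub>C g x"] that by (simp add: gin hg hD KD)
    show "norm (g x) \<le> (1 / c) * norm x" if "x \<in> K" for x
      using below(1)[OF gin[OF that]] c hg[OF that] by (simp add: field_simps)
  qed (rule gin)
  then show ?thesis using gh hg unfolding invertible_on_def by blast
qed

text \<open>Expanding the nonnegative number \<^term>\<open>Re (cinner (k (x - t *\<^sub>R k x)) (x - t *\<^sub>R k x))\<close> for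
  \<^term>\<open>t = 1 / M\<close> gives this form of the Cauchy-Schwarz inequality.\<close>
lemma positive_norm_sq_le:
  assumes K: "closed_csubspace K" and k: "bounded_clinear_on K k"
    and sym: "\<And>x y. x \<in> K \<Longrightarrow> y \<in> K \<Longrightarrow> cinner (k x) y = cinner x (k y)"
    and pos: "\<And>x. x \<in> K \<Longrightarrow> 0 \<le> Re (cinner (k x) x)"
    and M: "M > 0" "\<And>x. x \<in> K \<Longrightarrow> norm (k x) \<le> M * norm x" and x: "x \<in> K"
  shows "(norm (k x))\<^sup>2 \<le> M * Re (cinner (k x) x)"
proof -
  note KD = closed_csubspaceD[OF K] and kD = bounded_clinear_onD[OF k] bounded_clinear_on_more[OF k K]
  define y where "y = k x"
  have y: "y \<in> K" by (simp add: y_def kD x)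
  have "0 \<le> Re (cinner (k (x - (1/M) *\<^sub>R y)) (x - (1/M) *\<^sub>R y))"
    by (intro pos KD x y)
  also have "\<dots> = Re (cinner y x) - 2 * (1/M) * (norm y)\<^sup>2 + (1/M)\<^sup>2 * Re (cinner (k y) y)"
  proof -
    have "cinner (k y) x = cinner y y" using sym[OF y x] by (simp add: y_def)
    moreover have "k (x - (1/M) *\<^sub>R y) = y - (1/M) *\<^sub>R k y"
      using x y by (simp add: kD KD y_def)
    ultimately show ?thesis
      by (simp only: cinner_algebra norm_sq_cinner)
        (simp add: y_def[symmetric] power2_eq_square algebra_simps)
  qed
  also have "(1/M)\<^sup>2 * Re (cinner (k y) y) \<le> (1/M)\<^sup>2 * (M * (norm y)\<^sup>2)"
  proof (rule mult_left_mono)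
    have "Re (cinner (k y) y) \<le> norm (k y) * norm y" by (rule Re_cinner_le)
    also have "\<dots> \<le> (M * norm y) * norm y" by (intro mult_right_mono M y) simp
    finally show "Re (cinner (k y) y) \<le> M * (norm y)\<^sup>2" by (simp add: power2_eq_square)
  qed simp
  finally have "0 \<le> Re (cinner y x) - (1/M) * (norm y)\<^sup>2"
    using M(1) by (simp add: power2_eq_square)
  then show ?thesis using M(1) by (simp add: y_def field_simps)
qed

text \<open>The infimum of the numerical range of a symmetric operator belongs to its spectrum: unit
  vectors at which the infimum is nearly attained are nearly annihilated by the shifted operator,
  because the shifted operator is positive and satisfies the inequality of Cauchy and Schwarz.\<close>
lemma symmetric_negative_spectrum:
  assumes K: "closed_csubspace K" and h: "bounded_clinear_on K h"
    and sym: "\<And>x y. x \<in> K \<Longrightarrow> y \<in> K \<Longrightarrow> cinner (h x) y = cinner x (h y)"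
    and x0: "x0 \<in> K" "Re (cinner (h x0) x0) < 0"
  obtains l :: real where "l < 0" "\<not> invertible_on K (\<lambda>x. h x - complex_of_real l *\<^sub>C x)"
proof -
  note KD = closed_csubspaceD[OF K] and hD = bounded_clinear_onD[OF h] bounded_clinear_on_more[OF h K]
  obtain B where B: "B > 0" "\<And>x. x \<in> K \<Longrightarrow> norm (h x) \<le> B * norm x"
    using bounded_clinear_onE[OF h] by metis
  define W where "W = {Re (cinner (h x) x) |x. x \<in> K \<and> norm x = 1}"
  define l where "l = Inf W"
  have x0': "norm x0 > 0" using x0(2) by auto
  have scaled: "Re (cinner (h x) x) / (norm x)\<^sup>2 \<in> W" if "x \<in> K" "x \<noteq> 0" for x
  proof -
    let ?u = "(1 / norm x) *\<^sub>R x"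
    have "Re (cinner (h ?u) ?u) = Re (cinner (h x) x) / (norm x)\<^sup>2"
      using that by (simp add: hD cinner_algebra power2_eq_square)
    moreover have "?u \<in> K" "norm ?u = 1" using that by (simp_all add: KD)
    then have "Re (cinner (h ?u) ?u) \<in> W" unfolding W_def by blast
    ultimately show ?thesis by simp
  qed
  have "\<bar>w\<bar> \<le> B" if "w \<in> W" for w
  proof -
    obtain x where x: "w = Re (cinner (h x) x)" "x \<in> K" "norm x = 1" using \<open>w \<in> W\<close> by (auto simp: W_def)
    then show ?thesis
      using B(2)[of x] Cauchy_Schwarz_cinner[of "h x" x] abs_Re_le_cmod[of "cinner (h x) x"] by simp
  qed
  then have "- B \<le> w" if "w \<in> W" for w using \<open>\<And>w. w \<in> W \<Longrightarrow> \<bar>w\<bar> \<le> B\<close>[OF that] by linarith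
  then have bdd: "bdd_below W" by (rule bdd_belowI)
  have "l \<le> Re (cinner (h x0) x0) / (norm x0)\<^sup>2"
    unfolding l_def using bdd scaled x0(1) x0' by (intro cInf_lower) auto
  also have "\<dots> < 0" using x0(2) x0' by (simp add: divide_neg_pos)
  finally have neg: "l < 0" .
  define k where "k x = h x - complex_of_real l *\<^sub>C x" for x
  have bound: "norm (k x) \<le> (B + \<bar>l\<bar>) * norm x" if "x \<in> K" for x
    using norm_triangle_ineq4[of "h x" "complex_of_real l *\<^sub>C x"] B(2)[OF that]
    by (simp add: k_def norm_scaleC algebra_simps)
  have k: "bounded_clinear_on K k"
    by (rule bounded_clinear_onI[OF _ _ _ bound])
      (simp_all add: k_def hD KD scaleC_add_right scaleC_diff_right scaleC_scaleC mult.commute)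
  have ksym: "cinner (k x) y = cinner x (k y)" if "x \<in> K" "y \<in> K" for x y
    using that by (simp add: k_def cinner_algebra sym)
  have kRe: "Re (cinner (k x) x) = Re (cinner (h x) x) - l * (norm x)\<^sup>2" for x
    by (simp add: k_def cinner_algebra cinner_self flip: of_real_power)
  have kpos: "0 \<le> Re (cinner (k x) x)" if "x \<in> K" for x
  proof (cases "x = 0")
    case False
    have "l \<le> Re (cinner (h x) x) / (norm x)\<^sup>2"
      unfolding l_def using bdd scaled that False by (intro cInf_lower)
    then show ?thesis using False by (simp add: kRe field_simps)
  qed simp
  have "\<not> invertible_on K k"
  proof
    assume "invertible_on K k"
    then obtain g where g: "bounded_clinear_on K g" "\<And>x. x \<in> K \<Longrightarrow> g (k x) = x"
      unfolding invertible_on_def by blast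
    obtain C where C: "C > 0" "\<And>x. x \<in> K \<Longrightarrow> norm (g x) \<le> C * norm x"
      using bounded_clinear_onE[OF g(1)] by metis
    define M where "M = B + \<bar>l\<bar>"
    have M: "M > 0" using B(1) by (simp add: M_def)
    have "W \<noteq> {}" using scaled x0(1) x0' by force
    then obtain w where "w \<in> W" "w < l + 1 / (C\<^sup>2 * M)"
      using cInf_lessD[of W "l + 1 / (C\<^sup>2 * M)"] C(1) M by (auto simp: l_def)
    then obtain x where x: "x \<in> K" "norm x = 1" "Re (cinner (h x) x) < l + 1 / (C\<^sup>2 * M)"
      by (auto simp: W_def)
    have "(norm (k x))\<^sup>2 \<le> M * Re (cinner (k x) x)"
      using positive_norm_sq_le[OF K k ksym kpos M _ x(1)] bound M_def by blast
    also have "\<dots> < M * (1 / (C\<^sup>2 * M))" using x M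
      by (intro mult_strict_left_mono) (simp_all add: kRe del: mult_divide_mult_cancel_left_if)
    also have "\<dots> = 1 / C\<^sup>2" using M by simp
    finally have "(C * norm (k x))\<^sup>2 < 1"
      using C(1) by (simp add: field_simps power_mult_distrib)
    moreover have "1 \<le> C * norm (k x)"
      using C(2)[OF bounded_clinear_onD(1)[OF k x(1)]] g(2)[OF x(1)] x(2) by simp
    then have "1 \<le> (C * norm (k x))\<^sup>2" by (simp add: one_le_power)
    ultimately show False by simp
  qed
  then show thesis using that neg unfolding k_def by blast
qed

locale positive_on = operator_on +
  assumes sym: "\<And>x y. x \<in> K \<Longrightarrow> y \<in> K \<Longrightarrow> cinner (f x) y = cinner x (f y)"
    and pos: "\<And>x. x \<in> K \<Longrightarrow> 0 \<le> Re (cinner (f x) x)"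
begin

lemma Im_cinner_f: assumes "x \<in> K" shows "Im (cinner (f x) x) = 0"
proof -
  have "cinner (f x) x = cnj (cinner (f x) x)"
    using sym[OF assms assms] cinner_commute by metis
  then show ?thesis by (metis Reals_cnj_iff complex_is_Real_iff)
qed

text \<open>A quadratic form that is bounded away from zero makes the shifted operator and its adjoint
  bounded below.\<close>
lemma shift_invertible:
  assumes c: "c > 0"
    and below: "\<And>x. x \<in> K \<Longrightarrow> c * (norm x)\<^sup>2 \<le> cmod (cinner (f x - z *\<^sub>C x) x)"
    "\<And>x. x \<in> K \<Longrightarrow> c * (norm x)\<^sup>2 \<le> cmod (cinner (f x - cnj z *\<^sub>C x) x)"
  shows "invertible_on K (\<lambda>x. f x - z *\<^sub>C x)"
proof -
  have le: "c * norm x \<le> norm y" if "c * (norm x)\<^sup>2 \<le> cmod (cinner y x)" for x y :: 'a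
  proof (cases "x = 0")
    case False
    have "(c * norm x) * norm x \<le> norm y * norm x"
      using that Cauchy_Schwarz_cinner[of y x] by (simp add: power2_eq_square)
    then show ?thesis using False by simp
  qed simp
  obtain B where B: "B > 0" "\<And>x. x \<in> K \<Longrightarrow> norm (f x) \<le> B * norm x"
    using bounded_clinear_onE[OF f] by metis
  have "bounded_clinear_on K (\<lambda>x. f x - z *\<^sub>C x)"
  proof (rule bounded_clinear_onI)
    show "norm (f x - z *\<^sub>C x) \<le> (B + cmod z) * norm x" if "x \<in> K" for x
      using norm_triangle_ineq4[of "f x" "z *\<^sub>C x"] B(2)[OF that]
      by (simp add: norm_scaleC algebra_simps)
  qed (simp_all add: fD KD scaleC_add_right scaleC_diff_right scaleC_scaleC mult.commute)
  then show ?thesis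
    using c below le
    by (intro bounded_below_invertible[OF K, where h' = "\<lambda>x. f x - cnj z *\<^sub>C x" and c = c])
      (simp_all add: fD KD cinner_algebra sym)
qed

text \<open>For \<^term>\<open>z\<close> off the interval from \<open>0\<close> to \<^term>\<open>M\<close> the quadratic form of the shifted
  operator is bounded away from zero, by \<^term>\<open>\<bar>Im z\<bar>\<close>, by \<^term>\<open>- Re z\<close> or by
  \<^term>\<open>Re z - M\<close>.\<close>
lemma spectrum_nonneg:
  assumes M: "\<And>x. x \<in> K \<Longrightarrow> norm (f x) \<le> M * norm x" and z: "z \<in> spectrum_on K f"
  shows "z = complex_of_real (Re z)" "0 \<le> Re z" "Re z \<le> M"
proof -
  have Re: "Re (cinner (f x - z *\<^sub>C x) x) = Re (cinner (f x) x) - Re z * (norm x)\<^sup>2"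
    and Im: "x \<in> K \<Longrightarrow> Im (cinner (f x - z *\<^sub>C x) x) = - Im z * (norm x)\<^sup>2" for x z
    by (simp_all add: cinner_algebra cinner_self Im_cinner_f flip: of_real_power)
  have le: "Re (cinner (f x) x) \<le> M * (norm x)\<^sup>2" if "x \<in> K" for x
    using Re_cinner_le[of "f x" x] mult_right_mono[OF M[OF that], of "norm x"]
    by (simp add: power2_eq_square)
  have ninv: "\<not> invertible_on K (\<lambda>x. f x - z *\<^sub>C x)" using z by (simp add: spectrum_on_iff)
  have *: "c * (norm x)\<^sup>2 \<le> cmod w" if "c * (norm x)\<^sup>2 \<le> \<bar>Re w\<bar> \<or> c * (norm x)\<^sup>2 \<le> \<bar>Im w\<bar>"
    for c w and x :: 'a
    using that abs_Re_le_cmod[of w] abs_Im_le_cmod[of w] by linarith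
  have "Im z = 0"
  proof (rule ccontr)
    assume "Im z \<noteq> 0"
    then have "invertible_on K (\<lambda>x. f x - z *\<^sub>C x)"
      by (intro shift_invertible[of "\<bar>Im z\<bar>"] *) (simp_all add: Im abs_mult)
    then show False using ninv by simp
  qed
  then show "z = complex_of_real (Re z)" by (simp add: complex_eq_iff)
  show "0 \<le> Re z"
  proof (rule ccontr)
    assume neg: "\<not> 0 \<le> Re z"
    have "- Re z * (norm x)\<^sup>2 \<le> \<bar>Re (cinner (f x) x) - Re z * (norm x)\<^sup>2\<bar>" if "x \<in> K" for x
      using pos[OF that] by linarith
    then have "invertible_on K (\<lambda>x. f x - z *\<^sub>C x)"
      using neg by (intro shift_invertible[of "- Re z"] *) (simp_all add: Re)
    then show False using ninv by simp
  qed
  show "Re z \<le> M"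
  proof (rule ccontr)
    assume gt: "\<not> Re z \<le> M"
    have "(Re z - M) * (norm x)\<^sup>2 \<le> \<bar>Re (cinner (f x) x) - Re z * (norm x)\<^sup>2\<bar>" if "x \<in> K" for x
      using le[OF that] by (simp add: algebra_simps)
    then have "invertible_on K (\<lambda>x. f x - z *\<^sub>C x)"
      using gt by (intro shift_invertible[of "Re z - M"] *) (simp_all add: Re)
    then show False using ninv by simp
  qed
qed

lemma spectrum_real: assumes "z \<in> spectrum_on K f" shows "cnj z = z"
proof -
  obtain B where "\<And>x. x \<in> K \<Longrightarrow> norm (f x) \<le> B * norm x"
    using bounded_clinear_onE[OF f] by metis
  then show ?thesis using spectrum_nonneg(1)[of B z] assms by (metis complex_cnj_complex_of_real)
qed

text \<open>Subtracting more than the norm makes the operator negative, so the infimum of its numerical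
  range, shifted back, is a point of the spectrum.\<close>
lemma spectrum_nonempty: assumes "x \<in> K" "x \<noteq> 0" shows "spectrum_on K f \<noteq> {}"
proof -
  obtain B where B: "B > 0" "\<And>x. x \<in> K \<Longrightarrow> norm (f x) \<le> B * norm x"
    using bounded_clinear_onE[OF f] by metis
  define h where "h = op_poly [:- complex_of_real (B + 1), 1:] f"
  have h: "bounded_clinear_on K h" unfolding h_def by (rule op_poly_bounded_clinear)
  have h_eq: "h y = f y - complex_of_real (B + 1) *\<^sub>C y" if "y \<in> K" for y
    using that scaleC_minus_left[of "complex_of_real (B + 1)" y]
    by (simp add: h_def op_poly_pCons op_poly_0 fD)
  have "Re (cinner (f x) x) \<le> B * (norm x)\<^sup>2"
    using Re_cinner_le[of "f x" x] mult_right_mono[OF B(2)[OF assms(1)], of "norm x"]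
    by (simp add: power2_eq_square)
  moreover have "(norm x)\<^sup>2 > 0" using assms by simp
  ultimately have "Re (cinner (f x) x) - (B + 1) * (norm x)\<^sup>2 < 0"
    unfolding distrib_right by linarith
  then have "Re (cinner (h x) x) < 0"
    using assms(1) by (simp add: h_eq cinner_algebra cinner_self flip: of_real_power)
  moreover have "cinner (h y) y' = cinner y (h y')" if "y \<in> K" "y' \<in> K" for y y'
    using that by (simp add: h_eq cinner_algebra sym)
  ultimately obtain l where l: "\<not> invertible_on K (\<lambda>x. h x - complex_of_real l *\<^sub>C x)"
    using symmetric_negative_spectrum[OF K h _ assms(1)] by metis
  have "h y - complex_of_real l *\<^sub>C y = f y - complex_of_real (B + 1 + l) *\<^sub>C y" if "y \<in> K" for y
    using that by (simp only: h_eq of_real_add[of "B + 1" l] scaleC_add_left diff_diff_eq)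
  then have "\<not> invertible_on K (\<lambda>x. f x - complex_of_real (B + 1 + l) *\<^sub>C x)"
    using l unfolding invertible_on_def by (smt (verit) bounded_clinear_onD(1))
  then show ?thesis using spectrum_on_iff by blast
qed

text \<open>If the operator \<^term>\<open>op_poly q f\<close> were not positive then some \<^term>\<open>l < 0\<close> would lie in its
  spectrum, and a linear factor of \<^term>\<open>q - [:complex_of_real l:]\<close> would fail to be
  invertible at \<^term>\<open>f\<close>.\<close>
lemma op_poly_positive:
  assumes qsym: "\<And>x y. x \<in> K \<Longrightarrow> y \<in> K \<Longrightarrow> cinner (op_poly q f x) y = cinner x (op_poly q f y)"
    and q: "\<And>z. z \<in> spectrum_on K f \<Longrightarrow> 0 \<le> Re (poly q z)" and x: "x \<in> K"
  shows "0 \<le> Re (cinner (op_poly q f x) x)"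
proof (rule ccontr)
  assume neg: "\<not> ?thesis"
  then obtain l :: real where l: "l < 0"
    "\<not> invertible_on K (\<lambda>x. op_poly q f x - complex_of_real l *\<^sub>C x)"
    using symmetric_negative_spectrum[OF K op_poly_bounded_clinear[of q] qsym x] by force
  define p where "p = q - [:complex_of_real l:]"
  have "op_poly p f y = op_poly q f y - complex_of_real l *\<^sub>C y" if "y \<in> K" for y
    using that by (simp add: p_def op_poly_diff op_poly_const)
  then have ninv: "\<not> invertible_on K (op_poly p f)"
    using l(2) unfolding invertible_on_def by (smt (verit) bounded_clinear_onD(1))
  have "x \<noteq> 0" using neg by auto
  then have "p \<noteq> 0"
    using q spectrum_nonempty[OF x] l(1) by (fastforce simp: p_def)
  then obtain z where z: "poly p z = 0" "z \<in> spectrum_on K f"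
    using op_poly_invertible ninv by blast
  then have "Re (poly q z) = l" by (simp add: p_def)
  then show False using q[OF z(2)] l(1) by simp
qed

lemma op_poly_adjoint:
  assumes "x \<in> K" "y \<in> K"
  shows "cinner (op_poly p f x) y = cinner x (op_poly (map_poly cnj p) f y)"
  using assms
proof (induction p arbitrary: y)
  case (pCons a p)
  have fop: "f (op_poly q f u) = op_poly q f (f u)" if "u \<in> K" for q u
    using op_poly_mult[OF that, of q "[:0,1:]"] op_poly_mult[OF that, of "[:0,1:]" q] that
    by (simp add: op_poly_pCons op_poly_0 op_poly_in fD mult.commute)
  have "cinner (f (op_poly p f x)) y = cinner (op_poly p f x) (f y)"
    using sym[OF op_poly_in] pCons.prems by simp
  also have "\<dots> = cinner x (f (op_poly (map_poly cnj p) f y))"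
    using pCons.IH[of "f y"] pCons.prems by (simp add: fD fop)
  finally show ?case
    using pCons.prems by (simp add: op_poly_pCons map_poly_pCons cinner_algebra)
qed (simp add: op_poly_0)

text \<open>Apply positivity to the polynomial \<open>m\<^sup>2 - p* p\<close>, where \<open>p*\<close> has the conjugate
  coefficients.\<close>
lemma norm_op_poly_le:
  assumes m: "0 \<le> m" "\<And>z. z \<in> spectrum_on K f \<Longrightarrow> cmod (poly p z) \<le> m" and x: "x \<in> K"
  shows "norm (op_poly p f x) \<le> m * norm x"
proof -
  define q where "q = [:complex_of_real (m\<^sup>2):] - map_poly cnj p * p"
  have cc: "map_poly cnj (map_poly cnj p) = p"
    by (rule poly_eqI) (simp add: coeff_map_poly)
  have q_eq: "cinner (op_poly q f u) v = complex_of_real (m\<^sup>2) * cinner u v - cinner (op_poly p f u) (op_poly p f v)"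
    if "u \<in> K" "v \<in> K" for u v
    using that op_poly_adjoint[of "op_poly p f u" v "map_poly cnj p"] cc
    by (simp add: q_def op_poly_diff op_poly_const op_poly_mult cinner_algebra op_poly_in del: of_real_power)
  have qsym: "cinner (op_poly q f u) v = cinner u (op_poly q f v)" if "u \<in> K" "v \<in> K" for u v
    using q_eq[OF that] q_eq[OF that(2,1)] cinner_commute[of u "op_poly q f v"]
      cinner_commute[of u v] cinner_commute[of "op_poly p f u" "op_poly p f v"] by simp
  have "0 \<le> Re (poly q z)" if "z \<in> spectrum_on K f" for z
  proof -
    have "poly (map_poly cnj p) z = cnj (poly p z)"
      using poly_cnj[of p z] spectrum_real[OF that] by simp
    then have "poly q z = complex_of_real (m\<^sup>2 - (cmod (poly p z))\<^sup>2)"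
      by (simp add: q_def complex_norm_square mult.commute del: of_real_power)
    moreover have "(cmod (poly p z))\<^sup>2 \<le> m\<^sup>2" using m that by (intro power_mono) auto
    ultimately show ?thesis by simp
  qed
  then have "0 \<le> Re (cinner (op_poly q f x) x)" using op_poly_positive[OF qsym _ x] by blast
  also have "\<dots> = (m * norm x)\<^sup>2 - (norm (op_poly p f x))\<^sup>2"
    by (simp add: q_eq[OF x x] cinner_self power_mult_distrib flip: of_real_power)
  finally have "(norm (op_poly p f x))\<^sup>2 \<le> (m * norm x)\<^sup>2" by simp
  then show ?thesis by (rule power2_le_imp_le) (simp add: m(1))
qed

end

section \<open>Continuous functional calculus and powers of a positive operator\<close>

lemma opnorm_on_le:
  assumes "\<And>x. x \<in> K \<Longrightarrow> norm (F x) \<le> e * norm x" "0 \<le> e"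
  shows "0 \<le> opnorm_on K F" "opnorm_on K F \<le> e"
proof -
  have le: "w \<le> e" if "w \<in> insert 0 {norm (F x) |x. x \<in> K \<and> norm x = 1}" for w
    using that assms by force
  then have "bdd_above (insert 0 {norm (F x) |x. x \<in> K \<and> norm x = 1})"
    by (rule bdd_aboveI)
  then show "0 \<le> opnorm_on K F" unfolding opnorm_on_def by (intro cSup_upper) auto
  show "opnorm_on K F \<le> e" unfolding opnorm_on_def using le by (intro cSup_least) auto
qed

lemma norm_le_opnorm_on:
  assumes K: "closed_csubspace K" and F: "bounded_clinear_on K F" and x: "x \<in> K"
  shows "norm (F x) \<le> opnorm_on K F * norm x"
proof (cases "x = 0")
  case True then show ?thesis using bounded_clinear_on_more(1)[OF F K] by simp
next
  case False
  obtain B where B: "B > 0" "\<And>x. x \<in> K \<Longrightarrow> norm (F x) \<le> B * norm x"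
    using bounded_clinear_onE[OF F] by metis
  have le: "w \<le> B" if "w \<in> insert 0 {norm (F x) |x. x \<in> K \<and> norm x = 1}" for w
    using that B by force
  have bdd: "bdd_above (insert 0 {norm (F x) |x. x \<in> K \<and> norm x = 1})"
    by (rule bdd_aboveI[OF le])
  let ?u = "(1 / norm x) *\<^sub>R x"
  have "?u \<in> K" "norm ?u = 1" using x False by (simp_all add: closed_csubspaceD[OF K])
  then have "norm (F ?u) \<le> opnorm_on K F"
    unfolding opnorm_on_def using bdd by (intro cSup_upper) blast+
  moreover have "norm (F ?u) = norm (F x) / norm x"
    using bounded_clinear_on_more(2)[OF F K x] by simp
  ultimately show ?thesis using False by (simp add: field_simps)
qed

lemma bounded_clinear_on_diff:
  assumes K: "closed_csubspace K" and F: "bounded_clinear_on K F" and G: "bounded_clinear_on K G"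
  shows "bounded_clinear_on K (\<lambda>x. F x - G x)"
proof -
  obtain B where B: "B > 0" "\<And>x. x \<in> K \<Longrightarrow> norm (F x) \<le> B * norm x"
    using bounded_clinear_onE[OF F] by metis
  obtain C where C: "C > 0" "\<And>x. x \<in> K \<Longrightarrow> norm (G x) \<le> C * norm x"
    using bounded_clinear_onE[OF G] by metis
  show ?thesis
  proof (rule bounded_clinear_onI)
    show "norm (F x - G x) \<le> (B + C) * norm x" if "x \<in> K" for x
      using norm_triangle_ineq4[of "F x" "G x"] B(2)[OF that] C(2)[OF that]
      by (simp add: distrib_right)
  qed (simp_all add: closed_csubspaceD[OF K] bounded_clinear_onD[OF F] bounded_clinear_onD[OF G]
      scaleC_diff_right)
qed

lemma bounded_clinear_on_add:
  assumes K: "closed_csubspace K" and F: "bounded_clinear_on K F" and G: "bounded_clinear_on K G"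
  shows "bounded_clinear_on K (\<lambda>x. F x + G x)"
proof -
  obtain B where B: "B > 0" "\<And>x. x \<in> K \<Longrightarrow> norm (F x) \<le> B * norm x"
    using bounded_clinear_onE[OF F] by metis
  obtain C where C: "C > 0" "\<And>x. x \<in> K \<Longrightarrow> norm (G x) \<le> C * norm x"
    using bounded_clinear_onE[OF G] by metis
  show ?thesis
  proof (rule bounded_clinear_onI)
    show "norm (F x + G x) \<le> (B + C) * norm x" if "x \<in> K" for x
      using norm_triangle_ineq[of "F x" "G x"] B(2)[OF that] C(2)[OF that]
      by (simp add: distrib_right)
  qed (simp_all add: closed_csubspaceD[OF K] bounded_clinear_onD[OF F] bounded_clinear_onD[OF G]
      scaleC_add_right)
qed

text \<open>Convexity on the open half-line gives the tangent bound there; the end point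
  \<^term>\<open>u = 0\<close> and the degenerate tangent at \<^term>\<open>b = 0\<close> need separate treatment.\<close>
lemma powr_ge_tangent:
  fixes a b u :: real
  assumes "a \<ge> 1" "b \<ge> 0" "u \<ge> 0"
  shows "b powr a + a * b powr (a - 1) * (u - b) \<le> u powr a"
proof (cases "b = 0")
  case False
  then have b: "b > 0" using assms by simp
  show ?thesis
  proof (cases "u = 0")
    case True
    have "b powr (a - 1) * b = b powr a" using powr_add[of b "a - 1" 1] b by simp
    then have "b powr a + a * b powr (a - 1) * (0 - b) = (1 - a) * b powr a"
      by (simp add: algebra_simps)
    also have "\<dots> \<le> 0" using assms by (simp add: mult_nonpos_nonneg)
    finally show ?thesis using True by simp
  next
    case False
    have "((\<lambda>x. x powr a) has_real_derivative a * b powr (a - 1)) (at b within {0<..})"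
      using has_real_derivative_powr[OF b] DERIV_subset by blast
    then have "a * b powr (a - 1) * (u - b) \<le> u powr a - b powr a"
      using convex_on_imp_above_tangent[OF powr_convex[OF assms(1)], of b u "a * b powr (a - 1)"]
        b False assms(3) by (simp add: interior_open)
    then show ?thesis by simp
  qed
qed simp

lemma powr_midpoint_convex:
  fixes c w s :: real
  assumes "s \<ge> 1" "c \<ge> 0" "w \<ge> 0"
  shows "((c + w) / 2) powr s \<le> (c powr s + w powr s) / 2"
proof -
  define b where "b = (c + w) / 2"
  define k where "k = s * b powr (s - 1)"
  have "b powr s + k * (c - b) \<le> c powr s" "b powr s + k * (w - b) \<le> w powr s"
    unfolding k_def using assms by (intro powr_ge_tangent; simp add: b_def)+
  moreover have "k * (w - b) = - (k * (c - b))"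
    unfolding mult_minus_right[symmetric] by (simp add: b_def field_simps)
  ultimately have "b powr s \<le> (c powr s + w powr s) / 2" by argo
  then show ?thesis by (simp add: b_def)
qed

text \<open>Real coefficients matter because they make the approximating operators symmetric.\<close>
lemma powr_polynomial_approx:
  fixes s M e :: real
  assumes s: "s > 0" and e: "e > 0"
  obtains p :: "complex poly" where "\<And>i. coeff p i \<in> \<real>"
    "\<And>t. 0 \<le> t \<Longrightarrow> t \<le> M \<Longrightarrow> cmod (poly p (complex_of_real t) - complex_of_real (t powr s)) < e"
proof -
  have "continuous_on {0..M} (\<lambda>t. t powr s)"
    using s by (intro continuous_on_powr' continuous_intros) auto
  then obtain g where g: "real_polynomial_function g" "\<And>t. t \<in> {0..M} \<Longrightarrow> \<bar>t powr s - g t\<bar> < e"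
    using Stone_Weierstrass_real_polynomial_function[of "{0..M}" "\<lambda>t. t powr s" e] e by auto
  obtain a n where a: "g = (\<lambda>t. \<Sum>i\<le>n. a i * t ^ i)"
    using g(1) real_polynomial_function_iff_sum by auto
  define p where "p = (\<Sum>i\<le>n. monom (complex_of_real (a i)) i)"
  have "poly p (complex_of_real t) = complex_of_real (g t)" for t
    by (simp add: p_def a poly_sum poly_monom)
  then have "cmod (poly p (complex_of_real t) - complex_of_real (t powr s)) < e"
    if "0 \<le> t" "t \<le> M" for t
    using g(2)[of t] that by (simp add: norm_minus_commute flip: of_real_diff)
  moreover have "coeff p i \<in> \<real>" for i
    by (auto simp: p_def coeff_sum intro!: sum_in_Reals)
  ultimately show thesis using that by blast
qed

context positive_on
begin

lemma op_poly_close: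
  assumes p: "uniform_limit (spectrum_on K f) (\<lambda>n z. poly (p n) z) \<phi> sequentially"
    and q: "uniform_limit (spectrum_on K f) (\<lambda>n z. poly (q n) z) \<phi> sequentially" and e: "e > 0"
  obtains N where "\<And>m n x. m \<ge> N \<Longrightarrow> n \<ge> N \<Longrightarrow> x \<in> K \<Longrightarrow>
    norm (op_poly (p m) f x - op_poly (q n) f x) \<le> e * norm x"
proof -
  obtain N1 where N1: "\<And>n z. n \<ge> N1 \<Longrightarrow> z \<in> spectrum_on K f \<Longrightarrow> dist (poly (p n) z) (\<phi> z) < e / 2"
    using uniform_limitD[OF p, of "e / 2"] e by (auto simp: eventually_sequentially)
  obtain N2 where N2: "\<And>n z. n \<ge> N2 \<Longrightarrow> z \<in> spectrum_on K f \<Longrightarrow> dist (poly (q n) z) (\<phi> z) < e / 2"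
    using uniform_limitD[OF q, of "e / 2"] e by (auto simp: eventually_sequentially)
  have "norm (op_poly (p m) f x - op_poly (q n) f x) \<le> e * norm x"
    if "m \<ge> max N1 N2" "n \<ge> max N1 N2" "x \<in> K" for m n x
  proof -
    have "cmod (poly (p m - q n) z) \<le> e" if z: "z \<in> spectrum_on K f" for z
      using N1[of m z] N2[of n z] z \<open>m \<ge> max N1 N2\<close> \<open>n \<ge> max N1 N2\<close>
        dist_triangle2[of "poly (p m) z" "poly (q n) z" "\<phi> z"] by (simp add: dist_norm)
    then show ?thesis
      using norm_op_poly_le[of e "p m - q n" x] e that(3) by (simp add: op_poly_diff)
  qed
  then show thesis using that by blast
qed

text \<open>The norm bound makes the operators \<^term>\<open>op_poly (p n) f\<close> a Cauchy sequence, with a limit that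
  does not depend on the approximating polynomials.\<close>
lemma fun_calc_on_limit:
  assumes p: "uniform_limit (spectrum_on K f) (\<lambda>n z. poly (p n) z) \<phi> sequentially"
  shows "bounded_clinear_on K (fun_calc_on K \<phi> f)"
    and "\<And>x. x \<in> K \<Longrightarrow> (\<lambda>n. op_poly (p n) f x) \<longlonglongrightarrow> fun_calc_on K \<phi> f x"
proof -
  have "\<exists>y. (\<lambda>n. op_poly (p n) f x) \<longlonglongrightarrow> y" if x: "x \<in> K" for x
  proof -
    have "Cauchy (\<lambda>n. op_poly (p n) f x)"
    proof (rule metric_CauchyI)
      fix e :: real assume "e > 0"
      define k where "k = norm x + 1"
      have k: "k > 0" "norm x < k" using norm_ge_zero[of x] by (simp_all add: k_def add_nonneg_pos)
      define d where "d = e / k"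
      have d: "d > 0" using \<open>e > 0\<close> k by (simp add: d_def)
      obtain N where N: "\<And>m n. m \<ge> N \<Longrightarrow> n \<ge> N \<Longrightarrow>
          norm (op_poly (p m) f x - op_poly (p n) f x) \<le> d * norm x"
        using op_poly_close[OF p p d] x by metis
      have "d * norm x < d * k" using d k by simp
      then have "d * norm x < e" using k by (simp add: d_def)
      then show "\<exists>M. \<forall>m\<ge>M. \<forall>n\<ge>M. dist (op_poly (p m) f x) (op_poly (p n) f x) < e"
        using N by (intro exI[of _ N]) (auto simp: dist_norm intro: le_less_trans)
    qed
    then show ?thesis using convergent_eq_Cauchy by blast
  qed
  then obtain L where L: "\<And>x. x \<in> K \<Longrightarrow> (\<lambda>n. op_poly (p n) f x) \<longlonglongrightarrow> L x" by metis
  define g where "g x = (if x \<in> K then L x else 0)" for x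
  have lim: "(\<lambda>n. op_poly (p n) f x) \<longlonglongrightarrow> g x" if "x \<in> K" for x
    using L that by (simp add: g_def)
  have approx: "\<exists>N. \<forall>n\<ge>N. \<forall>x\<in>K. norm (op_poly (q n) f x - g x) \<le> e * norm x"
    if q: "uniform_limit (spectrum_on K f) (\<lambda>n z. poly (q n) z) \<phi> sequentially" and e: "e > 0" for q e
  proof -
    obtain N where N: "\<And>m n x. m \<ge> N \<Longrightarrow> n \<ge> N \<Longrightarrow> x \<in> K \<Longrightarrow>
        norm (op_poly (q m) f x - op_poly (p n) f x) \<le> e * norm x"
      using op_poly_close[OF q p e] by metis
    have "norm (op_poly (q m) f x - g x) \<le> e * norm x" if "m \<ge> N" "x \<in> K" for m x
    proof (rule tendsto_upperbound)
      show "(\<lambda>n. norm (op_poly (q m) f x - op_poly (p n) f x)) \<longlonglongrightarrow> norm (op_poly (q m) f x - g x)"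
        by (intro tendsto_intros lim that)
      show "\<forall>\<^sub>F n in sequentially. norm (op_poly (q m) f x - op_poly (p n) f x) \<le> e * norm x"
        using N[OF that(1) _ that(2)] by (auto simp: eventually_sequentially)
    qed simp
    then show ?thesis by blast
  qed
  note pD = bounded_clinear_onD[OF op_poly_bounded_clinear]
  have g: "bounded_clinear_on K g"
  proof -
    obtain N where N: "\<And>x. x \<in> K \<Longrightarrow> norm (op_poly (p N) f x - g x) \<le> 1 * norm x"
      using approx[OF p, of 1] by auto
    obtain B where B: "\<And>x. x \<in> K \<Longrightarrow> norm (op_poly (p N) f x) \<le> B * norm x"
      using bounded_clinear_onE[OF op_poly_bounded_clinear[of "p N"]] by metis
    show ?thesis
    proof (rule bounded_clinear_onI)
      show "g x \<in> K" if "x \<in> K" for x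
        using closed_sequentially[OF KD(1) _ lim[OF that]] op_poly_in[OF that] by blast
      show "g (x + y) = g x + g y" if "x \<in> K" "y \<in> K" for x y
      proof (rule LIMSEQ_unique[OF lim])
        show "(\<lambda>n. op_poly (p n) f (x + y)) \<longlonglongrightarrow> g x + g y"
          using tendsto_add[OF lim[OF that(1)] lim[OF that(2)]] by (simp add: pD that)
      qed (simp add: KD that)
      show "g (c *\<^sub>C x) = c *\<^sub>C g x" if "x \<in> K" for c x
      proof (rule LIMSEQ_unique[OF lim])
        show "(\<lambda>n. op_poly (p n) f (c *\<^sub>C x)) \<longlonglongrightarrow> c *\<^sub>C g x"
          using tendsto_scaleC[OF lim[OF that]] by (simp add: pD that)
      qed (simp add: KD that)
      show "norm (g x) \<le> (B + 1) * norm x" if "x \<in> K" for x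
        using N[OF that] B[OF that] norm_triangle_ineq4[of "op_poly (p N) f x" "op_poly (p N) f x - g x"]
        by (simp add: distrib_right)
    qed
  qed
  have "fun_calc_on K \<phi> f = g"
    unfolding fun_calc_on_def
  proof (rule the_equality, intro conjI allI impI)
    fix q assume q: "uniform_limit (spectrum_on K f) (\<lambda>n z. poly (q n) z) \<phi> sequentially"
    show "(\<lambda>n. opnorm_on K (\<lambda>x. op_poly (q n) f x - g x)) \<longlonglongrightarrow> 0"
    proof (rule LIMSEQ_I)
      fix e :: real assume "e > 0"
      then obtain N where N: "\<And>n x. n \<ge> N \<Longrightarrow> x \<in> K \<Longrightarrow> norm (op_poly (q n) f x - g x) \<le> (e / 2) * norm x"
        using approx[OF q, of "e / 2"] by auto
      have "norm (opnorm_on K (\<lambda>x. op_poly (q n) f x - g x) - 0) < e" if "n \<ge> N" for n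
        using opnorm_on_le[of K "\<lambda>x. op_poly (q n) f x - g x" "e / 2"] N[OF that] \<open>e > 0\<close> by simp
      then show "\<exists>no. \<forall>n\<ge>no. norm (opnorm_on K (\<lambda>x. op_poly (q n) f x - g x) - 0) < e" by blast
    qed
  next
    fix g' assume g': "bounded_clinear_on K g' \<and> (\<forall>x. x \<notin> K \<longrightarrow> g' x = 0) \<and>
        (\<forall>p. uniform_limit (spectrum_on K f) (\<lambda>n z. poly (p n) z) \<phi> sequentially \<longrightarrow>
             (\<lambda>n. opnorm_on K (\<lambda>x. op_poly (p n) f x - g' x)) \<longlonglongrightarrow> 0)"
    show "g' = g"
    proof
      fix x show "g' x = g x"
      proof (cases "x \<in> K")
        case True
        have "(\<lambda>n. opnorm_on K (\<lambda>x. op_poly (p n) f x - g' x) * norm x) \<longlonglongrightarrow> 0 * norm x"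
          using g' p by (intro tendsto_intros) blast
        then have null: "(\<lambda>n. opnorm_on K (\<lambda>x. op_poly (p n) f x - g' x) * norm x) \<longlonglongrightarrow> 0" by simp
        have "norm (op_poly (p n) f x - g' x) \<le> opnorm_on K (\<lambda>x. op_poly (p n) f x - g' x) * norm x" for n
          using norm_le_opnorm_on[OF K bounded_clinear_on_diff[OF K op_poly_bounded_clinear] True] g'
          by blast
        then have "\<forall>\<^sub>F n in sequentially. norm (op_poly (p n) f x - g' x)
            \<le> opnorm_on K (\<lambda>x. op_poly (p n) f x - g' x) * norm x" by simp
        then have "(\<lambda>n. op_poly (p n) f x - g' x) \<longlonglongrightarrow> 0"
          using null by (rule Lim_null_comparison)
        then have "(\<lambda>n. op_poly (p n) f x) \<longlonglongrightarrow> g' x" by (rule LIM_zero_cancel)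
        then show ?thesis using lim[OF True] LIMSEQ_unique by blast
      next
        case False then show ?thesis using g' by (simp add: g_def)
      qed
    qed
  qed (use g in \<open>simp_all add: g_def\<close>)
  then show "bounded_clinear_on K (fun_calc_on K \<phi> f)"
    and "\<And>x. x \<in> K \<Longrightarrow> (\<lambda>n. op_poly (p n) f x) \<longlonglongrightarrow> fun_calc_on K \<phi> f x"
    using g lim by simp_all
qed

text \<open>This is Jensen's inequality for the spectral measure of \<^term>\<open>f\<close> at \<^term>\<open>x\<close>, whose second
  moment is \<^term>\<open>(norm (f x))\<^sup>2\<close>: the power \<open>t\<^sup>s\<close> is convex as a function of \<open>t\<^sup>2\<close>, so it lies above
  its tangent at the second moment, and that tangent is a polynomial in \<open>t\<close>.\<close>
lemma op_poly_powr_lower: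
  assumes real: "\<And>i. coeff p i \<in> \<real>" and s: "s \<ge> 2"
    and p: "\<And>z. z \<in> spectrum_on K f \<Longrightarrow> Re z powr s - e \<le> Re (poly p z)"
    and x: "x \<in> K" "norm x = 1"
  shows "norm (f x) powr s - e \<le> Re (cinner (op_poly p f x) x)"
proof -
  define b where "b = (norm (f x))\<^sup>2"
  define c where "c = s / 2 * b powr (s / 2 - 1)"
  \<comment> \<open>\<open>q\<close> is \<open>p + e\<close> minus the tangent \<open>b\<^sup>s\<^sup>/\<^sup>2 + c (t\<^sup>2 - b)\<close>.\<close>
  define d where "d = e - b powr (s / 2) + c * b"
  define q where "q = p + [:complex_of_real d, 0, - complex_of_real c:]"
  have "coeff q i \<in> \<real>" for i
    using real by (auto simp: q_def coeff_pCons split: nat.splits)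
  then have cq: "map_poly cnj q = q"
    by (intro poly_eqI) (auto simp: coeff_map_poly Reals_cnj_iff)
  obtain M where M: "\<And>x. x \<in> K \<Longrightarrow> norm (f x) \<le> M * norm x"
    using bounded_clinear_onE[OF f] by metis
  have "0 \<le> Re (poly q z)" if z: "z \<in> spectrum_on K f" for z
  proof -
    define t where "t = Re z"
    have t: "z = complex_of_real t" "0 \<le> t" using spectrum_nonneg[OF M z] by (simp_all add: t_def)
    have "b powr (s / 2) + c * (t\<^sup>2 - b) \<le> (t\<^sup>2) powr (s / 2)"
      unfolding c_def using s by (intro powr_ge_tangent) (simp_all add: b_def)
    also have "(t\<^sup>2) powr (s / 2) = t powr s"
      using t(2) powr_powr[of t 2 "s / 2"] by (cases "t = 0") simp_all
    finally have "0 \<le> t powr s - e + d - c * t\<^sup>2" by (simp add: d_def algebra_simps)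
    also have "\<dots> \<le> Re (poly p z) + d - c * t\<^sup>2" using p[OF z] by (simp add: t_def)
    also have "\<dots> = Re (poly q z)"
      by (simp add: q_def t(1) power2_eq_square)
    finally show ?thesis .
  qed
  then have "0 \<le> Re (cinner (op_poly q f x) x)"
    using op_poly_positive[OF _ _ x(1), of q] op_poly_adjoint[of _ _ q] by (simp add: cq)
  also have "\<dots> = Re (cinner (op_poly p f x) x) + d - c * b"
  proof -
    have "op_poly q f x = op_poly p f x + complex_of_real d *\<^sub>C x - complex_of_real c *\<^sub>C f (f x)"
      using x by (simp add: q_def op_poly_add op_poly_pCons op_poly_0 fD KD scaleC_minus_left
          scaleC_minus_right)
    moreover have "cinner (f (f x)) x = complex_of_real b"
      using sym[of "f x" x] x by (simp add: fD cinner_self b_def)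
    ultimately show ?thesis
      using x(2) by (simp add: cinner_algebra cinner_self)
  qed
  finally have "b powr (s / 2) - e \<le> Re (cinner (op_poly p f x) x)" by (simp add: d_def)
  moreover have "b powr (s / 2) = norm (f x) powr s"
    using powr_powr[of "norm (f x)" 2 "s / 2"] by (cases "f x = 0") (simp_all add: b_def)
  ultimately show ?thesis by simp
qed

lemma op_poly_monom: "x \<in> K \<Longrightarrow> op_poly (monom 1 n) f x = (f ^^ n) x"
  by (induction n) (simp_all add: monom_0 monom_Suc op_poly_const op_poly_pCons op_poly_0 fD del: monom_eq_1)

lemma funpow_powr_lower:
  assumes n: "n \<ge> 2" and x: "x \<in> K" "norm x = 1"
  shows "norm (f x) powr real n \<le> Re (cinner ((f ^^ n) x) x)"
proof -
  obtain M where M: "\<And>x. x \<in> K \<Longrightarrow> norm (f x) \<le> M * norm x"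
    using bounded_clinear_onE[OF f] by metis
  have "norm (f x) powr real n - 0 \<le> Re (cinner (op_poly (monom 1 n) f x) x)"
  proof (rule op_poly_powr_lower[OF _ _ _ x])
    show "Re z powr real n - 0 \<le> Re (poly (monom 1 n) z)" if z: "z \<in> spectrum_on K f" for z
    proof -
      have "Re (z ^ n) = Re z ^ n"
        using spectrum_nonneg(1)[OF M z] by (metis Re_complex_of_real of_real_power)
      moreover have "Re z powr real n = Re z ^ n"
        using spectrum_nonneg(2)[OF M z] n powr_realpow[of "Re z" n] by (cases "Re z = 0") auto
      ultimately show ?thesis by (simp add: poly_monom)
    qed
  qed (use n in \<open>auto simp: coeff_monom\<close>)
  then show ?thesis using x by (simp add: op_poly_monom)
qed

lemma op_powr_on:
  assumes s: "s \<ge> 2"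
  shows "bounded_clinear_on K (op_powr_on K f s)"
    and "\<And>x. x \<in> K \<Longrightarrow> norm x = 1 \<Longrightarrow> norm (f x) powr s \<le> Re (cinner (op_powr_on K f s x) x)"
proof -
  obtain M where M: "\<And>x. x \<in> K \<Longrightarrow> norm (f x) \<le> M * norm x"
    using bounded_clinear_onE[OF f] by metis
  have "\<exists>p :: complex poly. (\<forall>i. coeff p i \<in> \<real>) \<and> (\<forall>t. 0 \<le> t \<longrightarrow> t \<le> M \<longrightarrow>
    cmod (poly p (complex_of_real t) - complex_of_real (t powr s)) < inverse (real (Suc n)))" for n
    using powr_polynomial_approx[of s "inverse (real (Suc n))" M] s by (metis inverse_positive_iff_positive of_nat_0_less_iff zero_less_Suc less_le_trans zero_less_numeral)
  then obtain p :: "nat \<Rightarrow> complex poly" where real: "\<And>n i. coeff (p n) i \<in> \<real>"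
    and p: "\<And>n t. 0 \<le> t \<Longrightarrow> t \<le> M \<Longrightarrow>
      cmod (poly (p n) (complex_of_real t) - complex_of_real (t powr s)) < inverse (real (Suc n))"
    by metis
  have p': "cmod (poly (p n) z - complex_of_real (Re z powr s)) < inverse (real (Suc n))"
    if z: "z \<in> spectrum_on K f" for n z
    using p[of "Re z" n] spectrum_nonneg[OF M z] by simp
  have ul: "uniform_limit (spectrum_on K f) (\<lambda>n z. poly (p n) z)
      (\<lambda>z. complex_of_real (Re z powr s)) sequentially"
  proof (rule uniform_limitI)
    fix e :: real assume "e > 0"
    then obtain N where N: "inverse (real (Suc N)) < e" using reals_Archimedean by blast
    have "dist (poly (p n) z) (complex_of_real (Re z powr s)) < e"
      if "n \<ge> N" "z \<in> spectrum_on K f" for n z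
    proof -
      have "inverse (real (Suc n)) \<le> inverse (real (Suc N))" using that(1) by auto
      then show ?thesis using p'[OF that(2), of n] N unfolding dist_norm by linarith
    qed
    then show "\<forall>\<^sub>F n in sequentially. \<forall>z\<in>spectrum_on K f. dist (poly (p n) z) (complex_of_real (Re z powr s)) < e"
      by (auto simp: eventually_sequentially)
  qed
  show "bounded_clinear_on K (op_powr_on K f s)"
    unfolding op_powr_on_def by (rule fun_calc_on_limit(1)[OF ul])
  fix x assume x: "x \<in> K" "norm x = 1"
  have "norm (f x) powr s - inverse (real (Suc n)) \<le> Re (cinner (op_poly (p n) f x) x)" for n
  proof (rule op_poly_powr_lower[OF real s _ x])
    show "Re z powr s - inverse (real (Suc n)) \<le> Re (poly (p n) z)" if "z \<in> spectrum_on K f" for z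
      using p'[OF that, of n] abs_Re_le_cmod[of "poly (p n) z - complex_of_real (Re z powr s)"]
      by simp
  qed
  moreover have "(\<lambda>n. Re (cinner (op_poly (p n) f x) x)) \<longlonglongrightarrow> Re (cinner (op_powr_on K f s x) x)"
    unfolding op_powr_on_def
    by (intro tendsto_Re tendsto_cinner fun_calc_on_limit(2)[OF ul x(1)] tendsto_const)
  moreover have "(\<lambda>n. norm (f x) powr s - inverse (real (Suc n))) \<longlonglongrightarrow> norm (f x) powr s - 0"
    by (intro tendsto_intros LIMSEQ_inverse_real_of_nat)
  ultimately show "norm (f x) powr s \<le> Re (cinner (op_powr_on K f s x) x)"
    using LIMSEQ_le[of "\<lambda>n. norm (f x) powr s - inverse (real (Suc n))" "norm (f x) powr s - 0"
        "\<lambda>n. Re (cinner (op_poly (p n) f x) x)"] by auto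
qed

end

section \<open>Induced operators on the completion\<close>

context A_completed
begin

lemma dense: assumes "u \<in> K" obtains X where "(\<lambda>n. J (X n)) \<longlonglongrightarrow> u"
proof -
  obtain Y where Y: "\<And>n. Y n \<in> range J" "Y \<longlonglongrightarrow> u"
    using assms unfolding K_eq closure_sequential by blast
  then have "\<forall>n. \<exists>x. Y n = J x" by blast
  then obtain X where "\<And>n. Y n = J (X n)" by metis
  then have "(\<lambda>n. J (X n)) \<longlonglongrightarrow> u" using Y(2) by (simp flip: \<open>\<And>n. Y n = J (X n)\<close>)
  then show thesis by (rule that)
qed

lemma J_in: "J x \<in> K"
  using closure_subset[of "range J"] K_eq by auto

lemma limit_in: assumes "(\<lambda>n. J (X n)) \<longlonglongrightarrow> u" shows "u \<in> K"
  unfolding K_eq closure_sequential using assms by (intro exI[of _ "\<lambda>n. J (X n)"]) simp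

lemma K_subspace: "closed_csubspace K"
  unfolding closed_csubspace_def
proof (intro conjI ballI allI)
  show "closed K" by (simp add: K_eq)
  show "0 \<in> K" using J_in[of 0] J_scaleC[of 0 0] by simp
next
  fix u v assume "u \<in> K" "v \<in> K"
  then obtain X Y where "(\<lambda>n. J (X n)) \<longlonglongrightarrow> u" "(\<lambda>n. J (Y n)) \<longlonglongrightarrow> v"
    using dense by metis
  then have "(\<lambda>n. J (X n + Y n)) \<longlonglongrightarrow> u + v" unfolding J_add by (rule tendsto_add)
  then show "u + v \<in> K" by (rule limit_in)
next
  fix c u assume "u \<in> K"
  then obtain X where "(\<lambda>n. J (X n)) \<longlonglongrightarrow> u" using dense by metis
  then have "(\<lambda>n. J (c *\<^sub>C X n)) \<longlonglongrightarrow> c *\<^sub>C u" unfolding J_scaleC by (rule tendsto_scaleC)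
  then show "c *\<^sub>C u \<in> K" by (rule limit_in)
qed

end

text \<open>Linearity of \<^term>\<open>P\<close> is required after application of \<^term>\<open>J\<close> only, that is, up to the
  kernel of \<^term>\<open>A\<close>: this is all that the action of \<^term>\<open>P\<close> on the completion depends on.\<close>
locale A_positive_op = A_completed A K J
  for A :: "'h::chilbert_space \<Rightarrow> 'h" and K :: "'k::chilbert_space set" and J :: "'h \<Rightarrow> 'k" +
  fixes P :: "'h \<Rightarrow> 'h" and M :: real
  assumes P_add: "J (P (x + y)) = J (P x) + J (P y)" and P_scaleC: "J (P (c *\<^sub>C x)) = c *\<^sub>C J (P x)"
    and P_bound: "norm (J (P x)) \<le> M * norm (J x)" and M: "M > 0"
    and P_sym: "cinner (J (P x)) (J y) = cinner (J x) (J (P y))"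
    and P_pos: "0 \<le> Re (cinner (J (P x)) (J x))"
begin

abbreviation Pt :: "'k \<Rightarrow> 'k" where "Pt \<equiv> induced_op K J P"

text \<open>The bound makes \<open>J x \<mapsto> J (P x)\<close> a well-defined Lipschitz map on the range of
  \<^term>\<open>J\<close>, which extends to the closure \<^term>\<open>K\<close>; linearity passes to the limit.\<close>
lemma induced_op_exists:
  "\<exists>g. bounded_clinear_on K g \<and> (\<forall>x. x \<notin> K \<longrightarrow> g x = 0) \<and> (\<forall>x. g (J x) = J (P x))"
proof -
  have P_diff: "J (P (x - y)) = J (P x) - J (P y)" for x y
    using P_add[of "x - y" y] by simp
  define f0 where "f0 u = J (P (inv J u))" for u
  have J_inv: "J (inv J (J x)) = J x" for x by (simp add: f_inv_into_f)
  have dist_le: "norm (J (P x) - J (P y)) \<le> M * norm (J x - J y)" for x y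
    using P_bound[of "x - y"] by (simp add: P_diff J_diff)
  have f0: "f0 (J x) = J (P x)" for x
    using dist_le[of "inv J (J x)" x] by (simp add: f0_def J_inv)
  have "M-lipschitz_on (range J) f0"
    using M dist_le by (intro lipschitz_onI) (auto simp: f0 dist_norm)
  then obtain g0 where g0: "M-lipschitz_on K g0" "\<And>x. g0 (J x) = J (P x)"
    using lipschitz_extend_closure[of M "range J" f0] f0 K_eq by auto
  have lim: "(\<lambda>n. J (P (X n))) \<longlonglongrightarrow> g0 u" if X: "(\<lambda>n. J (X n)) \<longlonglongrightarrow> u" for X u
  proof -
    have "continuous_on K g0" using g0(1) by (rule lipschitz_on_continuous_on)
    then have "(\<lambda>n. g0 (J (X n))) \<longlonglongrightarrow> g0 u"
      using continuous_on_tendsto_compose[of K g0 "\<lambda>n. J (X n)" u sequentially]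
        X limit_in[OF X] J_in by simp
    then show ?thesis by (simp add: g0(2))
  qed
  have g0_0: "g0 0 = 0" using g0(2)[of 0] J_scaleC[of 0 0] P_scaleC[of 0 0] by simp
  define g where "g u = (if u \<in> K then g0 u else 0)" for u
  note KD = closed_csubspaceD[OF K_subspace]
  have "bounded_clinear_on K g"
  proof (rule bounded_clinear_onI)
    fix u assume u: "u \<in> K"
    obtain X where X: "(\<lambda>n. J (X n)) \<longlonglongrightarrow> u" using u by (rule dense)
    show "g u \<in> K" using limit_in[OF lim[OF X]] u by (simp add: g_def)
    show "norm (g u) \<le> M * norm u"
      using lipschitz_onD[OF g0(1) u KD(2)] u by (simp add: g_def g0_0)
    have "(\<lambda>n. J (c *\<^sub>C X n)) \<longlonglongrightarrow> c *\<^sub>C u" for c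
      unfolding J_scaleC by (rule tendsto_scaleC[OF X])
    from lim[OF this] have "g0 (c *\<^sub>C u) = c *\<^sub>C g0 u" for c
      unfolding P_scaleC using tendsto_scaleC[OF lim[OF X]] LIMSEQ_unique by blast
    then show "g (c *\<^sub>C u) = c *\<^sub>C g u" for c using u by (simp add: g_def KD)
    fix v assume v: "v \<in> K"
    obtain Y where Y: "(\<lambda>n. J (Y n)) \<longlonglongrightarrow> v" using v by (rule dense)
    have "(\<lambda>n. J (X n + Y n)) \<longlonglongrightarrow> u + v" unfolding J_add by (rule tendsto_add[OF X Y])
    from lim[OF this] have "g0 (u + v) = g0 u + g0 v"
      unfolding P_add using tendsto_add[OF lim[OF X] lim[OF Y]] LIMSEQ_unique by blast
    then show "g (u + v) = g u + g v" using u v by (simp add: g_def KD)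
  qed
  then show ?thesis
    by (intro exI[of _ g]) (simp add: g_def J_in g0(2))
qed

lemma induced_op:
  shows "bounded_clinear_on K Pt" and "Pt (J x) = J (P x)"
proof -
  have "g = g'"
    if g: "bounded_clinear_on K g \<and> (\<forall>x. x \<notin> K \<longrightarrow> g x = 0) \<and> (\<forall>x. g (J x) = J (P x))"
      and g': "bounded_clinear_on K g' \<and> (\<forall>x. x \<notin> K \<longrightarrow> g' x = 0) \<and> (\<forall>x. g' (J x) = J (P x))"
    for g g'
  proof
    fix u show "g u = g' u"
    proof (cases "u \<in> K")
      case True
      then obtain X where X: "(\<lambda>n. J (X n)) \<longlonglongrightarrow> u" by (rule dense)
      have "(\<lambda>n. J (P (X n))) \<longlonglongrightarrow> g u" "(\<lambda>n. J (P (X n))) \<longlonglongrightarrow> g' u"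
        using bounded_clinear_on_continuous[OF _ K_subspace J_in X, of g] g
          bounded_clinear_on_continuous[OF _ K_subspace J_in X, of g'] g' by simp_all
      then show ?thesis by (rule LIMSEQ_unique)
    next
      case False then show ?thesis using g g' by simp
    qed
  qed
  then have "\<exists>!g. bounded_clinear_on K g \<and> (\<forall>x. x \<notin> K \<longrightarrow> g x = 0) \<and> (\<forall>x. g (J x) = J (P x))"
    using induced_op_exists by blast
  from theI'[OF this] show "bounded_clinear_on K Pt" "Pt (J x) = J (P x)"
    unfolding induced_op_def by blast+
qed

lemma positive_on_induced_op: "positive_on K Pt"
proof
  show "closed_csubspace K" by (rule K_subspace)
  show "bounded_clinear_on K Pt" by (rule induced_op)
  have lim: "(\<lambda>n. J (P (X n))) \<longlonglongrightarrow> Pt u" if "(\<lambda>n. J (X n)) \<longlonglongrightarrow> u" for X u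
    using bounded_clinear_on_continuous[OF induced_op(1) K_subspace J_in that] by (simp add: induced_op)
  fix u assume u: "u \<in> K"
  obtain X where X: "(\<lambda>n. J (X n)) \<longlonglongrightarrow> u" using u by (rule dense)
  have "(\<lambda>n. Re (cinner (J (P (X n))) (J (X n)))) \<longlonglongrightarrow> Re (cinner (Pt u) u)"
    by (intro tendsto_Re tendsto_cinner lim X)
  then show "0 \<le> Re (cinner (Pt u) u)"
    by (rule LIMSEQ_le_const) (use P_pos in blast)
  fix v assume v: "v \<in> K"
  obtain Y where Y: "(\<lambda>n. J (Y n)) \<longlonglongrightarrow> v" using v by (rule dense)
  have "(\<lambda>n. cinner (J (P (X n))) (J (Y n))) \<longlonglongrightarrow> cinner (Pt u) v"
    by (intro tendsto_cinner lim X Y)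
  moreover have "(\<lambda>n. cinner (J (P (X n))) (J (Y n))) \<longlonglongrightarrow> cinner u (Pt v)"
    unfolding P_sym by (intro tendsto_cinner lim X Y)
  ultimately show "cinner (Pt u) v = cinner u (Pt v)" by (rule LIMSEQ_unique)
qed

lemma funpow_induced_op: "(Pt ^^ n) (J x) = J ((P ^^ n) x)"
  by (induction n) (simp_all add: induced_op)

end

context A_completed
begin

lemma A_positive_op_A_adjoint_compose:
  assumes T: "T \<in> A_adjointable A"
  obtains M where "A_positive_op A K J (A_adjoint A T \<circ> T) M"
proof -
  have Tb: "bounded_clinear_on UNIV T" using T by (simp add: A_adjointable_def)
  note TD = bounded_clinear_onD[OF Tb, simplified]
  let ?P = "A_adjoint A T \<circ> T"
  obtain M where M: "M > 0" "\<And>x. norm (J (?P x)) \<le> M * norm (J x)"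
    using A_adjoint_compose_bound[OF T] by (metis comp_apply)
  have inner: "cinner (J (?P x)) (J y) = cinner (J (T x)) (J (T y))" for x y
    by (simp add: cinner_A_adjoint_J[OF T])
  \<comment> \<open>An element of the range of \<open>J\<close> that is orthogonal to this range vanishes.\<close>
  have eq0: "J z = 0" if "\<And>y. cinner (J z) (J y) = 0" for z
    using that[of z] by (simp add: cinner_self)
  have "J (?P (x + y) - ?P x - ?P y) = 0" for x y
    by (rule eq0) (simp only: J_diff cinner_diff_left inner TD J_add cinner_add_left; simp)
  moreover have "J (?P (c *\<^sub>C x) - c *\<^sub>C ?P x) = 0" for c x
    by (rule eq0) (simp only: J_diff J_scaleC cinner_diff_left cinner_scaleC_left inner TD; simp)
  ultimately have "J (?P (x + y)) = J (?P x) + J (?P y)" "J (?P (c *\<^sub>C x)) = c *\<^sub>C J (?P x)" for x y c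
    unfolding J_diff J_scaleC right_minus_eq diff_diff_eq by (simp_all add: J_add)
  then have "A_positive_op A K J ?P M"
    using M
    by unfold_locales
      (simp_all add: cinner_J_A_adjoint[OF T] cinner_self cinner_A_adjoint_J[OF T])
  then show thesis by (rule that)
qed

lemma A_opnorm_upper:
  assumes bd: "\<And>x. norm (J (F x)) \<le> B * norm (J x)" and x: "norm (J x) = 1"
  shows "norm (J (F x)) \<le> A_opnorm A F"
proof -
  have "w \<le> max B 0" if "w \<in> insert 0 {A_norm A (F x) |x. A_norm A x = 1}" for w
  proof -
    have "norm (J (F y)) \<le> max B 0" if "norm (J y) = 1" for y
      using bd[of y] that by simp
    then show ?thesis using that by (auto simp: A_norm_J)
  qed
  then have "bdd_above (insert 0 {A_norm A (F x) |x. A_norm A x = 1})" by (rule bdd_aboveI)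
  then have "A_norm A (F x) \<le> A_opnorm A F"
    unfolding A_opnorm_def using x by (intro cSup_upper) (auto simp: A_norm_J)
  then show ?thesis by (simp add: A_norm_J)
qed

text \<open>The case distinction between integer and other exponents disappears here: in both cases the
  seminorm dominates the quadratic form of the sum of the powers at the unit vector.\<close>
lemma A_powr_sum_opnorm_lower:
  assumes P: "A_positive_op A K J P M" and Q: "A_positive_op A K J Q N"
    and s: "s \<ge> 2" and x: "norm (J x) = 1"
  shows "norm (J (P x)) powr s + norm (J (Q x)) powr s \<le> A_powr_sum_opnorm A K J P Q s"
proof -
  interpret P: A_positive_op A K J P M by (rule P)
  interpret Q: A_positive_op A K J Q N by (rule Q)
  interpret Pt: positive_on K "induced_op K J P" by (rule P.positive_on_induced_op)
  interpret Qt: positive_on K "induced_op K J Q" by (rule Q.positive_on_induced_op)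
  let ?p = "norm (J (P x)) powr s + norm (J (Q x)) powr s"
  have quad: "?p \<le> norm (y + z)"
    if "norm (J (P x)) powr s \<le> Re (cinner y (J x))" "norm (J (Q x)) powr s \<le> Re (cinner z (J x))" for y z
    using that Re_cinner_le[of "y + z" "J x"] x by (simp add: cinner_add_left)
  show ?thesis
  proof (cases "s \<in> \<nat>")
    case True
    then obtain n where n: "s = real n" by (elim Nats_cases)
    then have n2: "n \<ge> 2" using s by simp
    have pn: "?p \<le> norm (J ((P ^^ n) x) + J ((Q ^^ n) x))"
      using Pt.funpow_powr_lower[OF n2 J_in x] Qt.funpow_powr_lower[OF n2 J_in x]
      by (intro quad) (simp_all add: n P.induced_op Q.induced_op P.funpow_induced_op Q.funpow_induced_op)
    define F where "F u = (P ^^ n) u + (Q ^^ n) u" for u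
    have "bounded_clinear_on K (\<lambda>u. (induced_op K J P ^^ n) u + (induced_op K J Q ^^ n) u)"
    proof -
      have "bounded_clinear_on K (\<lambda>u. op_poly (monom 1 n) (induced_op K J P) u + op_poly (monom 1 n) (induced_op K J Q) u)"
        by (intro bounded_clinear_on_add K_subspace Pt.op_poly_bounded_clinear Qt.op_poly_bounded_clinear)
      then show ?thesis
        unfolding bounded_clinear_on_def
        by (simp add: Pt.op_poly_monom Qt.op_poly_monom closed_csubspaceD[OF K_subspace])
    qed
    then obtain B where B: "B > 0"
      "\<And>u. u \<in> K \<Longrightarrow> norm ((induced_op K J P ^^ n) u + (induced_op K J Q ^^ n) u) \<le> B * norm u"
      using bounded_clinear_onE by blast
    have "norm (J (F u)) \<le> B * norm (J u)" for u
      using B(2)[OF J_in, of u] by (simp add: F_def J_add P.funpow_induced_op Q.funpow_induced_op)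
    then have "norm (J (F x)) \<le> A_opnorm A F" using x by (rule A_opnorm_upper)
    moreover have "A_powr_sum_opnorm A K J P Q s = A_opnorm A F"
      using True by (simp add: A_powr_sum_opnorm_def n F_def[abs_def])
    ultimately show ?thesis using pn by (simp add: F_def J_add)
  next
    case False
    have "?p \<le> norm (op_powr_on K (induced_op K J P) s (J x) + op_powr_on K (induced_op K J Q) s (J x))"
      using Pt.op_powr_on(2)[OF s J_in x] Qt.op_powr_on(2)[OF s J_in x]
      by (intro quad) (simp_all add: P.induced_op Q.induced_op)
    also have "\<dots> \<le> A_powr_sum_opnorm A K J P Q s"
      using norm_le_opnorm_on[OF K_subspace bounded_clinear_on_add[OF K_subspace
          Pt.op_powr_on(1)[OF s] Qt.op_powr_on(1)[OF s]] J_in, of x] x False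
      by (simp add: A_powr_sum_opnorm_def)
    finally show ?thesis .
  qed
qed

text \<open>A bound for the quadratic form is what makes the supremum an upper bound.\<close>
lemma A_numrad_upper:
  assumes bd: "\<And>x. norm (J x) = 1 \<Longrightarrow> cmod (cinner (J (F x)) (J x)) \<le> B" and x: "norm (J x) = 1"
  shows "cmod (cinner (J (F x)) (J x)) \<le> A_numrad A F"
proof -
  have "w \<le> max B 0" if "w \<in> insert 0 {cmod (A_inner A (F x) x) |x. A_norm A x = 1}" for w
    using that bd by (force simp: A_norm_J A_inner_J)
  then have "bdd_above (insert 0 {cmod (A_inner A (F x) x) |x. A_norm A x = 1})" by (rule bdd_aboveI)
  then have "cmod (A_inner A (F x) x) \<le> A_numrad A F"
    unfolding A_numrad_def using x by (intro cSup_upper) (auto simp: A_norm_J)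
  then show ?thesis by (simp add: A_inner_J)
qed

lemma A_numrad_powr_le:
  assumes "\<And>x. norm (J x) = 1 \<Longrightarrow> cmod (cinner (J (F x)) (J x)) powr p \<le> R" "0 \<le> R" "p > 0"
  shows "A_numrad A F powr p \<le> R"
proof -
  have bd: "cmod (cinner (J (F x)) (J x)) \<le> R powr (1 / p)" if "norm (J x) = 1" for x
  proof -
    have "(cmod (cinner (J (F x)) (J x)) powr p) powr (1 / p) \<le> R powr (1 / p)"
      using assms that by (intro powr_mono2) auto
    then show ?thesis using assms(3) by (simp add: powr_powr)
  qed
  then have le: "w \<le> R powr (1 / p)"
    if "w \<in> insert 0 {cmod (A_inner A (F x) x) |x. A_norm A x = 1}" for w
    using that by (auto simp: A_norm_J A_inner_J)
  then have "bdd_above (insert 0 {cmod (A_inner A (F x) x) |x. A_norm A x = 1})" by (rule bdd_aboveI)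
  then have "0 \<le> A_numrad A F" unfolding A_numrad_def by (intro cSup_upper) auto
  moreover have "A_numrad A F \<le> R powr (1 / p)"
    unfolding A_numrad_def using le by (intro cSup_least) auto
  ultimately have "A_numrad A F powr p \<le> (R powr (1 / p)) powr p"
    using assms(3) by (intro powr_mono2) auto
  then show ?thesis using assms(2,3) by (simp add: powr_powr)
qed

end

section \<open>The numerical radius inequality\<close>

text \<open>The weight \<^term>\<open>l\<close> interpolates between the two bounds for \<^term>\<open>m\<close>.\<close>
lemma powr_interpolation:
  fixes m c w l s :: real
  assumes "0 \<le> m" "0 \<le> c" "0 \<le> w" "m \<le> c" "m \<le> (c + w) / 2" "1 \<le> s" "0 \<le> l" "l \<le> 1"
  shows "m powr s \<le> (1 - l / 2) * c powr s + l / 2 * w powr s"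
proof -
  have 1: "m powr s \<le> c powr s" using assms by (intro powr_mono2) auto
  have "m powr s \<le> ((c + w) / 2) powr s" using assms by (intro powr_mono2) auto
  also have "\<dots> \<le> (c powr s + w powr s) / 2" using assms by (intro powr_midpoint_convex) auto
  finally have 2: "m powr s \<le> (c powr s + w powr s) / 2" .
  have "m powr s = (1 - l) * m powr s + l * m powr s" by (simp add: algebra_simps)
  also have "\<dots> \<le> (1 - l) * c powr s + l * ((c powr s + w powr s) / 2)"
    using 1 2 assms by (intro add_mono mult_left_mono) auto
  also have "\<dots> = (1 - l / 2) * c powr s + l / 2 * w powr s" by (simp add: field_simps)
  finally show ?thesis .
qed

theorem theorem3p10:
  fixes A T S :: "'h::chilbert_space \<Rightarrow> 'h"
    and J :: "'h \<Rightarrow> 'k::chilbert_space" and K :: "'k set"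
    and \<alpha> \<beta> r :: real
  assumes "\<exists>x::'h. x \<noteq> 0"
    and "bounded_clinear_on UNIV A" and "cpositive A"
    and "A_completion A K J"
    and "T \<in> A_adjointable A" and "S \<in> A_adjointable A"
    and "0 \<le> \<alpha>" and "\<alpha> \<le> 1" and "1 \<le> r" and "0 \<le> \<beta>"
  shows "A_numrad A (A_adjoint A S \<circ> T) powr (4 * r)
    \<le> (1 + \<alpha> + 2 * \<beta>) / (8 * (1 + \<beta>))
        * (A_powr_sum_opnorm A K J (A_adjoint A T \<circ> T) (A_adjoint A S \<circ> S) (2 * r))\<^sup>2
      + (1 - \<alpha>) / (2 * (1 + \<beta>))
        * A_numrad A (A_adjoint A S \<circ> S \<circ> A_adjoint A T \<circ> T) powr (2 * r)"
proof -
  interpret A_completed A K J using assms by unfold_locales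
  define P where "P = A_adjoint A S \<circ> S"
  define Q where "Q = A_adjoint A T \<circ> T"
  define s where "s = 2 * r"
  define N where "N = A_powr_sum_opnorm A K J Q P s"
  define w where "w = A_numrad A (P \<circ> Q)"
  \<comment> \<open>The weights in the claim are \<open>(1 - l) / 4 + l / 8\<close> and \<open>l / 2\<close>: a convex combination of the
    Cauchy-Schwarz bound and the Buzano bound.\<close>
  define l where "l = (1 - \<alpha>) / (1 + \<beta>)"
  define R where "R = (2 - l) / 8 * N\<^sup>2 + l / 2 * w powr s"
  have s: "s \<ge> 2" using assms by (simp add: s_def)
  have l: "0 \<le> l" "l \<le> 1" using assms by (auto simp: l_def field_simps)
  obtain M1 where M1: "A_positive_op A K J P M1"
    using A_positive_op_A_adjoint_compose[OF assms(6)] unfolding P_def by blast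
  obtain M2 where M2: "A_positive_op A K J Q M2"
    using A_positive_op_A_adjoint_compose[OF assms(5)] unfolding Q_def by blast
  interpret P: A_positive_op A K J P M1 by (rule M1)
  interpret Q: A_positive_op A K J Q M2 by (rule M2)
  have QP: "cinner (J (P (Q x))) (J x) = cinner (J (Q x)) (J (P x))" for x by (rule P.P_sym)
  have w_upper: "cmod (cinner (J (Q x)) (J (P x))) \<le> w" if x: "norm (J x) = 1" for x
  proof -
    have "cmod (cinner (J ((P \<circ> Q) y)) (J y)) \<le> M2 * M1" if "norm (J y) = 1" for y
    proof -
      have "cmod (cinner (J (Q y)) (J (P y))) \<le> norm (J (Q y)) * norm (J (P y))"
        by (rule Cauchy_Schwarz_cinner)
      also have "\<dots> \<le> M2 * M1"
        using P.P_bound[of y] Q.P_bound[of y] P.M Q.M that by (intro mult_mono) auto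
      finally show ?thesis by (simp add: QP)
    qed
    then have "cmod (cinner (J ((P \<circ> Q) x)) (J x)) \<le> w" unfolding w_def using x by (rule A_numrad_upper)
    then show ?thesis by (simp add: QP)
  qed
  have bound: "cmod (cinner (J ((A_adjoint A S \<circ> T) x)) (J x)) powr (4 * r) \<le> R"
    if x: "norm (J x) = 1" for x
  proof -
    define e where "e = cmod (cinner (J (T x)) (J (S x)))"
    define a where "a = norm (J (Q x))"
    define b where "b = norm (J (P x))"
    have nonneg: "0 \<le> a" "0 \<le> b" "0 \<le> e" by (simp_all add: a_def b_def e_def)
    have "cinner (J (Q x)) (J x) = complex_of_real ((norm (J (T x)))\<^sup>2)"
      by (simp add: Q_def cinner_A_adjoint_J[OF assms(5)] cinner_self)
    then have qx: "cmod (cinner (J (Q x)) (J x)) = (norm (J (T x)))\<^sup>2"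
      by (simp del: of_real_power)
    have "cinner (J x) (J (P x)) = complex_of_real ((norm (J (S x)))\<^sup>2)"
      by (simp add: P_def cinner_J_A_adjoint[OF assms(6)] cinner_self)
    then have px: "cmod (cinner (J x) (J (P x))) = (norm (J (S x)))\<^sup>2"
      by (simp del: of_real_power)
    have "e\<^sup>2 \<le> (norm (J (T x)) * norm (J (S x)))\<^sup>2"
      unfolding e_def by (intro power_mono Cauchy_Schwarz_cinner) simp
    then have m: "e\<^sup>2 \<le> cmod (cinner (J (Q x)) (J x)) * cmod (cinner (J x) (J (P x)))"
      by (simp add: qx px power_mult_distrib)
    also have "\<dots> \<le> a * b"
      using Cauchy_Schwarz_cinner[of "J (Q x)" "J x"] Cauchy_Schwarz_cinner[of "J x" "J (P x)"] x
      by (intro mult_mono) (simp_all add: a_def b_def)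
    finally have m1: "e\<^sup>2 \<le> a * b" .
    have m2: "e\<^sup>2 \<le> (a * b + w) / 2"
      using m Buzano[OF x, of "J (Q x)" "J (P x)"] w_upper[OF x] by (simp add: a_def b_def)
    have w0: "0 \<le> w" using w_upper[OF x] norm_ge_zero order_trans by blast
    have "(e\<^sup>2) powr s \<le> (1 - l / 2) * (a * b) powr s + l / 2 * w powr s"
      using powr_interpolation[of "e\<^sup>2" "a * b" w s l] nonneg m1 m2 w0 s l by simp
    also have "\<dots> \<le> (1 - l / 2) * (N\<^sup>2 / 4) + l / 2 * w powr s"
    proof -
      have "(a * b) powr s = a powr s * b powr s" using nonneg by (simp add: powr_mult)
      also have "\<dots> \<le> (a powr s + b powr s)\<^sup>2 / 4"
        using zero_le_power2[of "a powr s - b powr s"] by (simp add: power2_eq_square algebra_simps)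
      also have "\<dots> \<le> N\<^sup>2 / 4"
        using A_powr_sum_opnorm_lower[OF M2 M1 s x]
        by (intro divide_right_mono power_mono) (simp_all add: a_def b_def N_def)
      finally show ?thesis using l by (simp add: mult_left_mono)
    qed
    also have "\<dots> = R" by (simp add: R_def field_simps)
    finally have "(e\<^sup>2) powr s \<le> R" .
    moreover have "(e\<^sup>2) powr s = e powr (4 * r)"
      using nonneg powr_powr[of e 2 s] by (cases "e = 0") (simp_all add: s_def)
    moreover have "cmod (cinner (J ((A_adjoint A S \<circ> T) x)) (J x)) = e"
      by (simp add: e_def cinner_A_adjoint_J[OF assms(6)])
    ultimately show ?thesis by simp
  qed
  have "0 \<le> R" using l by (simp add: R_def)
  then have "A_numrad A (A_adjoint A S \<circ> T) powr (4 * r) \<le> R"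
    using assms by (intro A_numrad_powr_le bound) simp_all
  also have "R = (1 + \<alpha> + 2 * \<beta>) / (8 * (1 + \<beta>)) * N\<^sup>2 + (1 - \<alpha>) / (2 * (1 + \<beta>)) * w powr s"
  proof -
    have "(2 - l) / 8 = (1 + \<alpha> + 2 * \<beta>) / (8 * (1 + \<beta>))" "l / 2 = (1 - \<alpha>) / (2 * (1 + \<beta>))"
      using assms by (simp_all add: l_def field_simps)
    then show ?thesis by (simp only: R_def)
  qed
  finally show ?thesis
    by (simp add: N_def w_def P_def Q_def s_def comp_assoc)
qed

end
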